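(* Let $M=V/\Gamma$ be a CHW manifold of complex dimension $n$ and let $\Lambda\subset\Gamma$ be the maximal lattice. Then, as a $\mathbb{Z}_2^{n-1}$-module, $\Lambda=L_1\oplus L_2$, where $L_1\cong L_{diag}$ and $L_1\otimes_{\mathbb{Z}}\mathbb{Q}\cong L_2\otimes_{\mathbb{Z}}\mathbb{Q}$ as $\mathbb{Q}[\mathbb{Z}_2^{n-1}]$-modules.
   Context: A flat Kähler manifold of complex dimension $n$ is a quotient $V/\Gamma$, $V\cong\mathbb{C}^n$, with $\Gamma$ a discrete, cocompact, torsion-free subgroup of $U(n)\ltimes\mathbb{C}^n$. A complex Hantzsche-Wendt manifold (CHW manifold) of complex dimension $n$ is a flat Kähler manifold of complex dimension $n$ whose holonomy group is isomorphic to $\mathbb{Z}_2^{n-1}$ and contained in $SU(n)$; such $n$ is necessarily odd. There is a short exact sequence $0\to\Lambda\to\Gamma\to\mathbb{Z}_2^{n-1}\to1$, where $\Lambda\cong\mathbb{Z}^{2n}$ is the maximal abelian (translation) subgroup of $\Gamma$, a lattice in $V$, and the quotient is the holonomy group; conjugation makes $\Lambda$ a $\mathbb{Z}_2^{n-1}$-module (the integral holonomy representation). In a suitable basis of $V$ the holonomy group is the group of all diagonal matrices with entries $\pm1$ and determinant $1$. $L_{diag}$ denotes the $\mathbb{Z}_2^{n-1}$-module of $\mathbb{Z}$-rank $n$ corresponding to a faithful representation $\varrho_{diag}:\mathbb{Z}_2^{n-1}\to SL_n(\mathbb{Z})$ whose image consists of diagonal matrices; here $\mathbb{Z}_2^{n-1}$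 is identified with the holonomy group so that $\varrho_{diag}$ is given by these same diagonal $\pm1$ matrices. *)

theory Defs
  imports "HOL-Analysis.Analysis" "HOL-Algebra.Free_Abelian_Groups"
begin

section \<open>The group of unitary affine motions\<close>

definition conj_transpose :: "complex^'n^'n \<Rightarrow> complex^'n^'n" where
  "conj_transpose A = (\<chi> i j. cnj (A $ j $ i))"

definition unitary_matrix :: "complex^'n^'n \<Rightarrow> bool" where
  "unitary_matrix A \<longleftrightarrow> A ** conj_transpose A = mat 1 \<and> conj_transpose A ** A = mat 1"

definition unitary_group :: "(complex^'n^'n) monoid" where
  "unitary_group = \<lparr>carrier = {A. unitary_matrix A}, monoid.mult = (**), one = mat 1\<rparr>"

text \<open>The pair \<open>(A, a)\<close> stands for the affine map \<open>x \<mapsto> A x + a\<close>.\<close>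

definition unitary_affine_group :: "((complex^'n^'n) \<times> (complex^'n)) monoid" where
  "unitary_affine_group =
     \<lparr>carrier = {g. unitary_matrix (fst g)},
      monoid.mult = (\<lambda>g h. (fst g ** fst h, fst g *v snd h + snd g)),
      one = (mat 1, 0)\<rparr>"

definition affine_act :: "(complex^'n^'n) \<times> (complex^'n) \<Rightarrow> complex^'n \<Rightarrow> complex^'n" where
  "affine_act g x = fst g *v x + snd g"

definition affine_orbit :: "((complex^'n^'n) \<times> (complex^'n)) set \<Rightarrow> complex^'n \<Rightarrow> (complex^'n) set" where
  "affine_orbit \<Gamma> x = (\<lambda>g. affine_act g x) ` \<Gamma>"

text \<open>The orbit space \<open>V/\<Gamma>\<close> with the quotient topology.\<close>

definition orbit_space :: "((complex^'n^'n) \<times> (complex^'n)) set \<Rightarrow> (complex^'n) set topology" where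
  "orbit_space \<Gamma> = topology (\<lambda>U. U \<subseteq> range (affine_orbit \<Gamma>) \<and> open (affine_orbit \<Gamma> -` U))"

section \<open>Complex Hantzsche-Wendt groups\<close>

text \<open>
  As \<open>U(n)\<close> is compact, \<open>\<Gamma>\<close> is cocompact in \<open>U(n) \<ltimes> V\<close> precisely when \<open>V/\<Gamma>\<close> is compact.
\<close>

definition flat_Kaehler_group :: "((complex^'n^'n) \<times> (complex^'n)) set \<Rightarrow> bool" where
  "flat_Kaehler_group \<Gamma> \<longleftrightarrow>
     subgroup \<Gamma> unitary_affine_group \<and>
     discrete \<Gamma> \<and>
     compact_space (orbit_space \<Gamma>) \<and>
     (\<forall>g\<in>\<Gamma>. \<forall>k::nat. k > 0 \<longrightarrow>
        g [^]\<^bsub>unitary_affine_group\<^esub> k = \<one>\<^bsub>unitary_affine_group\<^esub> \<longrightarrow> g = \<one>\<^bsub>unitary_affine_group\<^esub>)"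

definition holonomy :: "((complex^'n^'n) \<times> (complex^'n)) set \<Rightarrow> (complex^'n^'n) set" where
  "holonomy \<Gamma> = fst ` \<Gamma>"

definition holonomy_group :: "((complex^'n^'n) \<times> (complex^'n)) set \<Rightarrow> (complex^'n^'n) monoid" where
  "holonomy_group \<Gamma> = unitary_group\<lparr>carrier := holonomy \<Gamma>\<rparr>"

definition CHW_group :: "((complex^'n^'n) \<times> (complex^'n)) set \<Rightarrow> bool" where
  "CHW_group \<Gamma> \<longleftrightarrow>
     flat_Kaehler_group \<Gamma> \<and>
     holonomy_group \<Gamma> \<cong> product_group {..<CARD('n) - 1} (\<lambda>_. integer_mod_group 2) \<and>
     (\<forall>A\<in>holonomy \<Gamma>. det A = 1)"

text \<open>
  The translation subgroup is recorded by its translation vectors.  Under this identification the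
  conjugation action of \<open>\<Gamma>\<close> becomes the matrix action of the holonomy, see
  \<open>translation_conj\<close> below.
\<close>

definition translation_lattice :: "((complex^'n^'n) \<times> (complex^'n)) set \<Rightarrow> (complex^'n) set" where
  "translation_lattice \<Gamma> = {v. (mat 1, v) \<in> \<Gamma>}"

section \<open>Modules over the holonomy group\<close>

definition invariant_subgroup :: "(complex^'n^'n) set \<Rightarrow> (complex^'n) set \<Rightarrow> bool" where
  "invariant_subgroup H L \<longleftrightarrow>
     0 \<in> L \<and> (\<forall>x\<in>L. \<forall>y\<in>L. x + y \<in> L) \<and> (\<forall>x\<in>L. - x \<in> L) \<and> (\<forall>A\<in>H. \<forall>x\<in>L. A *v x \<in> L)"

definition equivariantly_isomorphic ::
  "'h set \<Rightarrow> ('h \<Rightarrow> 'a::ab_group_add \<Rightarrow> 'a) \<Rightarrow> 'a set \<Rightarrow> ('h \<Rightarrow> 'b::ab_group_add \<Rightarrow> 'b) \<Rightarrow> 'b set \<Rightarrow> bool"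
where
  "equivariantly_isomorphic H \<alpha> M \<beta> N \<longleftrightarrow>
     (\<exists>f. bij_betw f M N \<and> (\<forall>x\<in>M. \<forall>y\<in>M. f (x + y) = f x + f y) \<and>
          (\<forall>h\<in>H. \<forall>x\<in>M. f (\<alpha> h x) = \<beta> h (f x)))"

definition diagonal_sign_matrices :: "(int^'n^'n) set" where
  "diagonal_sign_matrices =
     {D. (\<forall>i j. i \<noteq> j \<longrightarrow> D $ i $ j = 0) \<and> (\<forall>i. D $ i $ i \<in> {1, -1}) \<and> det D = 1}"

text \<open>
  \<open>\<rho>\<close> expresses the holonomy in the basis given by the columns of \<open>P\<close>, in which it is the group of all
  diagonal sign matrices of determinant 1.  That \<open>\<rho>\<close> is then a faithful representation is
  \<open>diagonal_rep_mult\<close> and \<open>diagonal_rep_inj\<close> below.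
\<close>

definition diagonal_rep ::
  "((complex^'n^'n) \<times> (complex^'n)) set \<Rightarrow> (complex^'n^'n \<Rightarrow> int^'n^'n) \<Rightarrow> bool" where
  "diagonal_rep \<Gamma> \<rho> \<longleftrightarrow>
     (\<exists>P. invertible P \<and> (\<forall>A\<in>holonomy \<Gamma>. A ** P = P ** map_matrix of_int (\<rho> A))) \<and>
     \<rho> ` holonomy \<Gamma> = diagonal_sign_matrices"

section \<open>Tensoring with the rationals\<close>

text \<open>
  \<open>L \<otimes> \<rat>\<close> as the free abelian group on \<open>L \<times> \<rat>\<close> modulo the biadditivity relations, which already force
  the tensor product to be balanced over the integers.
\<close>

definition tensor_rat_free :: "'a::ab_group_add set \<Rightarrow> ('a \<times> rat \<Rightarrow>\<^sub>0 int) monoid" where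
  "tensor_rat_free L = free_Abelian_group (L \<times> UNIV)"

definition tensor_rat_relations :: "'a::ab_group_add set \<Rightarrow> ('a \<times> rat \<Rightarrow>\<^sub>0 int) set" where
  "tensor_rat_relations L =
     {frag_of (x + y, q) - frag_of (x, q) - frag_of (y, q) | x y q. x \<in> L \<and> y \<in> L} \<union>
     {frag_of (x, q + r) - frag_of (x, q) - frag_of (x, r) | x q r. x \<in> L}"

definition tensor_rat_kernel :: "'a::ab_group_add set \<Rightarrow> ('a \<times> rat \<Rightarrow>\<^sub>0 int) set" where
  "tensor_rat_kernel L = generate (tensor_rat_free L) (tensor_rat_relations L)"

definition tensor_rat :: "'a::ab_group_add set \<Rightarrow> ('a \<times> rat \<Rightarrow>\<^sub>0 int) set monoid" where
  "tensor_rat L = tensor_rat_free L Mod tensor_rat_kernel L"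

definition pure_tensor :: "'a::ab_group_add set \<Rightarrow> 'a \<Rightarrow> rat \<Rightarrow> ('a \<times> rat \<Rightarrow>\<^sub>0 int) set" where
  "pure_tensor L x q = tensor_rat_kernel L #>\<^bsub>tensor_rat_free L\<^esub> frag_of (x, q)"

text \<open>
  For an additive \<open>f\<close> mapping \<open>L\<close> to itself, the endomorphism of \<open>L \<otimes> \<rat>\<close> with
  \<open>x \<otimes> q \<mapsto> f x \<otimes> r q\<close> (see \<open>tensor_rat_act_pure\<close>), lifted from the free group to cosets.
\<close>

definition tensor_rat_act ::
  "'a::ab_group_add set \<Rightarrow> rat \<Rightarrow> ('a \<Rightarrow> 'a) \<Rightarrow> ('a \<times> rat \<Rightarrow>\<^sub>0 int) set \<Rightarrow> ('a \<times> rat \<Rightarrow>\<^sub>0 int) set" where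
  "tensor_rat_act L r f c =
     (\<Union>z\<in>c. tensor_rat_kernel L #>\<^bsub>tensor_rat_free L\<^esub>
              frag_extend (\<lambda>p. frag_of (f (fst p), r * snd p)) z)"

text \<open>
  An isomorphism of modules over the rational group ring of \<open>H\<close>.  The elements \<open>r A\<close> with \<open>r\<close> rational
  and \<open>A \<in> H\<close> generate the group ring additively, so commuting with them suffices.
\<close>

definition rationally_isomorphic ::
  "(complex^'n^'n) set \<Rightarrow> (complex^'n) set \<Rightarrow> (complex^'n) set \<Rightarrow> bool" where
  "rationally_isomorphic H L M \<longleftrightarrow>
     (\<exists>\<phi>. \<phi> \<in> iso (tensor_rat L) (tensor_rat M) \<and>
          (\<forall>r. \<forall>A\<in>H. \<forall>t\<in>carrier (tensor_rat L).
             \<phi> (tensor_rat_act L r ((*v) A) t) = tensor_rat_act M r ((*v) A) (\<phi> t)))"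

section \<open>Elementary properties of the definitions\<close>

lemma conj_transpose_mult: "conj_transpose (A ** B) = conj_transpose B ** conj_transpose A"
  by (simp add: conj_transpose_def matrix_matrix_mult_def vec_eq_iff mult.commute)

lemma conj_transpose_idem: "conj_transpose (conj_transpose A) = A"
  by (simp add: conj_transpose_def vec_eq_iff)

lemma conj_transpose_one: "conj_transpose (mat 1) = mat 1"
  by (simp add: conj_transpose_def mat_def vec_eq_iff)

lemma unitary_matrix_mult:
  assumes "unitary_matrix A" "unitary_matrix B"
  shows "unitary_matrix (A ** B)"
proof -
  have "(A ** B) ** (conj_transpose B ** conj_transpose A)
      = A ** (B ** conj_transpose B) ** conj_transpose A"
    by (simp add: matrix_mul_assoc)
  moreover have "(conj_transpose B ** conj_transpose A) ** (A ** B)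
      = conj_transpose B ** (conj_transpose A ** A) ** B"
    by (simp add: matrix_mul_assoc)
  ultimately show ?thesis
    using assms by (simp add: unitary_matrix_def conj_transpose_mult)
qed

lemma unitary_matrix_conj_transpose: "unitary_matrix A \<Longrightarrow> unitary_matrix (conj_transpose A)"
  by (simp add: unitary_matrix_def conj_transpose_idem)

lemma unitary_matrix_one: "unitary_matrix (mat 1)"
  by (simp add: unitary_matrix_def conj_transpose_one)

lemma group_unitary_group: "group unitary_group"
proof (rule groupI, goal_cases)
  case (5 A)
  then show ?case
    by (intro bexI[of _ "conj_transpose A"])
       (auto simp: unitary_group_def unitary_matrix_conj_transpose, simp add: unitary_matrix_def)
qed (auto simp: unitary_group_def unitary_matrix_mult unitary_matrix_one matrix_mul_assoc)

lemma group_unitary_affine_group: "group unitary_affine_group"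
proof (rule groupI, goal_cases)
  case (5 g)
  then show ?case
    by (intro bexI[of _ "(conj_transpose (fst g), - (conj_transpose (fst g) *v snd g))"])
       (auto simp: unitary_affine_group_def unitary_matrix_conj_transpose, 
        simp add: unitary_matrix_def)
qed (auto simp: unitary_affine_group_def unitary_matrix_mult unitary_matrix_one matrix_mul_assoc
       matrix_vector_mul_assoc matrix_vector_right_distrib)

lemma translation_conj:
  assumes "g \<in> carrier unitary_affine_group"
  shows "g \<otimes>\<^bsub>unitary_affine_group\<^esub> (mat 1, v) \<otimes>\<^bsub>unitary_affine_group\<^esub> inv\<^bsub>unitary_affine_group\<^esub> g
         = (mat 1, fst g *v v)"
proof -
  interpret group unitary_affine_group by (rule group_unitary_affine_group)
  have c: "(mat 1, w) \<in> carrier unitary_affine_group" for w :: "complex^'n"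
    by (simp add: unitary_affine_group_def unitary_matrix_one)
  have "g \<otimes>\<^bsub>unitary_affine_group\<^esub> (mat 1, v) = (mat 1, fst g *v v) \<otimes>\<^bsub>unitary_affine_group\<^esub> g"
    by (simp add: unitary_affine_group_def add.commute)
  then show ?thesis
    using assms c by (metis m_assoc r_inv r_one inv_closed)
qed

lemma map_matrix_of_int_mult:
  "map_matrix of_int (A ** B) = (map_matrix of_int A ** map_matrix of_int B :: complex^'n^'n)"
  by (simp add: vec_eq_iff matrix_matrix_mult_def)

lemma map_matrix_of_int_eq:
  "map_matrix of_int A = (map_matrix of_int B :: complex^'n^'n) \<Longrightarrow> A = B"
  by (simp add: vec_eq_iff)

lemma invertible_mult_left_cancel:
  fixes P :: "complex^'n^'n"
  assumes "invertible P" "P ** X = P ** Y"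
  shows "X = Y"
  using assms by (metis invertible_def matrix_mul_assoc matrix_mul_lid)

lemma diagonal_rep_mult:
  assumes "diagonal_rep \<Gamma> \<rho>" "A \<in> holonomy \<Gamma>" "B \<in> holonomy \<Gamma>" "A ** B \<in> holonomy \<Gamma>"
  shows "\<rho> (A ** B) = \<rho> A ** \<rho> B"
proof -
  obtain P where P: "invertible P" "\<And>A. A \<in> holonomy \<Gamma> \<Longrightarrow> A ** P = P ** map_matrix of_int (\<rho> A)"
    using assms(1) by (auto simp: diagonal_rep_def)
  have "P ** map_matrix of_int (\<rho> (A ** B)) = A ** (B ** P)"
    using P(2)[OF assms(4)] by (simp add: matrix_mul_assoc)
  also have "\<dots> = (A ** P) ** map_matrix of_int (\<rho> B)"
    using P(2)[OF assms(3)] by (simp add: matrix_mul_assoc)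
  also have "\<dots> = P ** map_matrix of_int (\<rho> A ** \<rho> B)"
    using P(2)[OF assms(2)] by (simp add: matrix_mul_assoc map_matrix_of_int_mult)
  finally show ?thesis
    using P(1) by (metis invertible_mult_left_cancel map_matrix_of_int_eq)
qed

lemma diagonal_rep_inj:
  assumes "diagonal_rep \<Gamma> \<rho>"
  shows "inj_on \<rho> (holonomy \<Gamma>)"
proof (rule inj_onI)
  fix A B assume AB: "A \<in> holonomy \<Gamma>" "B \<in> holonomy \<Gamma>" "\<rho> A = \<rho> B"
  obtain P where P: "invertible P" "\<And>A. A \<in> holonomy \<Gamma> \<Longrightarrow> A ** P = P ** map_matrix of_int (\<rho> A)"
    using assms by (auto simp: diagonal_rep_def)
  then have "A ** P = B ** P" using AB by metis
  then show "A = B"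
    using P(1) by (metis invertible_def matrix_mul_assoc matrix_mul_rid)
qed

lemma tensor_rat_relations_closed:
  assumes "\<And>x y. x \<in> L \<Longrightarrow> y \<in> L \<Longrightarrow> x + y \<in> L"
  shows "tensor_rat_relations L \<subseteq> carrier (tensor_rat_free L)"
proof -
  have [simp]: "Poly_Mapping.keys (frag_of (x, q)) \<subseteq> L \<times> UNIV" if "x \<in> L" for x :: 'a and q :: rat
    using that by simp
  show ?thesis
    unfolding tensor_rat_relations_def tensor_rat_free_def
    using assms by (auto dest!: subsetD[OF keys_diff] split: if_splits)
qed

lemma tensor_rat_kernel_subgroup:
  assumes "\<And>x y. x \<in> L \<Longrightarrow> y \<in> L \<Longrightarrow> x + y \<in> L"
  shows "subgroup (tensor_rat_kernel L) (tensor_rat_free L)"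
  unfolding tensor_rat_kernel_def
  by (rule group.generate_is_subgroup)
     (simp_all add: tensor_rat_free_def tensor_rat_relations_closed[OF assms, unfolded tensor_rat_free_def])

lemma tensor_rat_free_hom:
  assumes "\<And>x. x \<in> L \<Longrightarrow> f x \<in> L"
  shows "frag_extend (\<lambda>p. frag_of (f (fst p), r * snd p)) \<in> hom (tensor_rat_free L) (tensor_rat_free L)"
proof (rule homI)
  fix z assume "z \<in> carrier (tensor_rat_free L)"
  then show "frag_extend (\<lambda>p. frag_of (f (fst p), r * snd p)) z \<in> carrier (tensor_rat_free L)"
    using assms keys_frag_extend[of "\<lambda>p. frag_of (f (fst p), r * snd p)" z]
    by (fastforce simp: tensor_rat_free_def)
qed (simp add: tensor_rat_free_def frag_extend_add)

lemma tensor_rat_kernel_act: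
  assumes add: "\<And>x y. x \<in> L \<Longrightarrow> y \<in> L \<Longrightarrow> x + y \<in> L"
    and f: "\<And>x. x \<in> L \<Longrightarrow> f x \<in> L" "\<And>x y. x \<in> L \<Longrightarrow> y \<in> L \<Longrightarrow> f (x + y) = f x + f y"
    and z: "z \<in> tensor_rat_kernel L"
  shows "frag_extend (\<lambda>p. frag_of (f (fst p), r * snd p)) z \<in> tensor_rat_kernel L"
proof -
  let ?F = "frag_extend (\<lambda>p. frag_of (f (fst p), r * snd p))"
  interpret group_hom "tensor_rat_free L" "tensor_rat_free L" ?F
    using tensor_rat_free_hom[of L f r] f(1)
    by (auto simp: group_hom_def group_hom_axioms_def tensor_rat_free_def)
  have "?F ` tensor_rat_relations L \<subseteq> tensor_rat_relations L"
  proof (rule image_subsetI)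
    fix w assume "w \<in> tensor_rat_relations L"
    then consider x y q where "w = frag_of (x + y, q) - frag_of (x, q) - frag_of (y, q)" "x \<in> L" "y \<in> L"
      | x q s where "w = frag_of (x, q + s) - frag_of (x, q) - frag_of (x, s)" "x \<in> L"
      unfolding tensor_rat_relations_def by blast
    then show "?F w \<in> tensor_rat_relations L"
    proof cases
      case 1
      then have "?F w = frag_of (f x + f y, r * q) - frag_of (f x, r * q) - frag_of (f y, r * q)"
        using f(2) by (simp add: frag_extend_diff)
      then show ?thesis using 1 f(1) unfolding tensor_rat_relations_def by blast
    next
      case 2
      then have "?F w = frag_of (f x, r * q + r * s) - frag_of (f x, r * q) - frag_of (f x, r * s)"
        by (simp add: frag_extend_diff distrib_left)
      then show ?thesis using 2 f(1) unfolding tensor_rat_relations_def by blast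
    qed
  qed
  then have "generate (tensor_rat_free L) (?F ` tensor_rat_relations L) \<subseteq> tensor_rat_kernel L"
    unfolding tensor_rat_kernel_def by (rule G.mono_generate)
  then show ?thesis
    using z generate_img[OF tensor_rat_relations_closed[OF add]]
    unfolding tensor_rat_kernel_def by blast
qed

lemma tensor_rat_act_pure:
  assumes add: "\<And>x y. x \<in> L \<Longrightarrow> y \<in> L \<Longrightarrow> x + y \<in> L"
    and f: "\<And>x. x \<in> L \<Longrightarrow> f x \<in> L" "\<And>x y. x \<in> L \<Longrightarrow> y \<in> L \<Longrightarrow> f (x + y) = f x + f y"
    and x: "x \<in> L"
  shows "tensor_rat_act L r f (pure_tensor L x q) = pure_tensor L (f x) (r * q)"
proof -
  let ?F = "frag_extend (\<lambda>p. frag_of (f (fst p), r * snd p))"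
  let ?K = "tensor_rat_kernel L"
  interpret G: group "tensor_rat_free L" by (simp add: tensor_rat_free_def)
  have K: "subgroup ?K (tensor_rat_free L)" by (rule tensor_rat_kernel_subgroup[OF add])
  have fx: "frag_of (f x, r * q) \<in> carrier (tensor_rat_free L)"
    using f(1)[OF x] by (simp add: tensor_rat_free_def)
  have *: "?K #>\<^bsub>tensor_rat_free L\<^esub> ?F (k + frag_of (x, q)) = pure_tensor L (f x) (r * q)"
    if "k \<in> ?K" for k
  proof -
    have "?F (k + frag_of (x, q)) = ?F k + frag_of (f x, r * q)"
      by (simp add: frag_extend_add)
    moreover have k': "?F k \<in> ?K" by (rule tensor_rat_kernel_act[OF add f that])
    ultimately have "?F (k + frag_of (x, q)) \<in> ?K #>\<^bsub>tensor_rat_free L\<^esub> frag_of (f x, r * q)"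
      by (auto simp: r_coset_def tensor_rat_free_def)
    then show ?thesis
      using G.repr_independence[OF _ fx K] by (simp add: pure_tensor_def)
  qed
  have "pure_tensor L x q = (\<lambda>k. k + frag_of (x, q)) ` ?K"
    by (auto simp: pure_tensor_def r_coset_def tensor_rat_free_def)
  moreover have "?K \<noteq> {}" using subgroup.one_closed[OF K] by blast
  ultimately show ?thesis
    by (simp add: tensor_rat_act_def *)
qed

end

theory Submission
  imports Defs
begin

text \<open>
  In coordinates diagonalising the holonomy, let \<open>\<Lambda>\<^sub>i\<close> be the part of the lattice \<open>\<Lambda>\<close> on the \<open>i\<close>-th axis and
  \<open>\<pi>\<^sub>i\<close> the projection to that axis.  The dimension is odd, as otherwise an element of \<open>\<Gamma>\<close> over \<open>-1\<close> would
  be torsion; so some \<open>g \<in> \<Gamma>\<close> has linear part \<open>2\<pi>\<^sub>i - 1\<close>, whence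
  \<open>2\<Lambda>\<^sub>i \<subseteq> 2\<pi>\<^sub>i(\<Lambda>) \<subseteq> \<Lambda>\<^sub>i\<close>.
  Since no \<open>\<lambda>g\<close> with \<open>\<lambda> \<in> \<Lambda>\<close> squares to the identity, \<open>g\<^sup>2\<close> is a translation in \<open>\<Lambda>\<^sub>i\<close> outside
  \<open>2\<pi>\<^sub>i(\<Lambda>)\<close>, and the second inclusion is strict (for \<open>n = 1\<close> it is strict
  because \<open>2\<Lambda> \<noteq> \<Lambda>\<close>).  Hence the rank two lattice \<open>\<Lambda>\<^sub>i\<close> has a basis
  \<open>u\<^sub>i, v\<^sub>i\<close> with \<open>\<pi>\<^sub>i(\<Lambda>) \<subseteq> \<int>u\<^sub>i/2 + \<int>v\<^sub>i\<close>.  The \<open>v\<close>-component of every lattice vector is therefore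
  itself in \<open>\<Lambda>\<close>, so \<open>\<Lambda>\<close> is the direct sum of the span \<open>L\<^sub>1\<close> of the \<open>v\<^sub>i\<close> and of the part \<open>L\<^sub>2\<close> of \<open>\<Lambda>\<close> in
  the real span of the \<open>u\<^sub>i\<close>.  Swapping \<open>u\<^sub>i\<close> and \<open>v\<^sub>i\<close> embeds \<open>L\<^sub>1\<close> into \<open>L\<^sub>2\<close> with cokernel killed by \<open>2\<close>.
\<close>

section \<open>Functoriality of the rational tensor product\<close>

text \<open>The analogue of \<open>tensor_rat_act\<close> between two different groups, intended to
  send x \<otimes> q to f x \<otimes> r q. For additive \<open>f\<close> the united cosets all
  coincide, so the union is again a coset.\<close>

definition tensor_rat_map ::
  "'a::ab_group_add set \<Rightarrow> 'b::ab_group_add set \<Rightarrow> rat \<Rightarrow> ('a \<Rightarrow> 'b) \<Rightarrow>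
    ('a \<times> rat \<Rightarrow>\<^sub>0 int) set \<Rightarrow> ('b \<times> rat \<Rightarrow>\<^sub>0 int) set" where
  "tensor_rat_map L M r f c =
     (\<Union>z\<in>c. tensor_rat_kernel M #>\<^bsub>tensor_rat_free M\<^esub>
              frag_extend (\<lambda>p. frag_of (f (fst p), r * snd p)) z)"

lemma tensor_rat_act_eq_map: "tensor_rat_act L = tensor_rat_map L L"
  by (simp add: fun_eq_iff tensor_rat_act_def tensor_rat_map_def)

lemma carrier_tensor_rat:
  "carrier (tensor_rat L) =
     (\<lambda>z. tensor_rat_kernel L #>\<^bsub>tensor_rat_free L\<^esub> z) ` carrier (tensor_rat_free L)"
  by (simp add: tensor_rat_def carrier_FactGroup)

lemma mult_tensor_rat_free: "y \<otimes>\<^bsub>tensor_rat_free L\<^esub> z = y + z"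
  by (simp add: tensor_rat_free_def)

lemma mult_tensor_rat: "s \<otimes>\<^bsub>tensor_rat L\<^esub> t = s <#>\<^bsub>tensor_rat_free L\<^esub> t"
  by (simp add: tensor_rat_def)

lemma tensor_rat_kernel_normal:
  assumes "\<And>x y. x \<in> L \<Longrightarrow> y \<in> L \<Longrightarrow> x + y \<in> L"
  shows "tensor_rat_kernel L \<lhd> tensor_rat_free L"
proof -
  interpret comm_group "tensor_rat_free L"
    by (simp add: tensor_rat_free_def abelian_free_Abelian_group)
  show ?thesis
    using tensor_rat_kernel_subgroup[of L] assms by (simp add: normal_iff_subgroup)
qed

locale additive_between =
  fixes L :: "'a::ab_group_add set" and M :: "'b::ab_group_add set" and f :: "'a \<Rightarrow> 'b"
  assumes L_add: "x \<in> L \<Longrightarrow> y \<in> L \<Longrightarrow> x + y \<in> L"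
    and M_add: "x' \<in> M \<Longrightarrow> y' \<in> M \<Longrightarrow> x' + y' \<in> M"
    and maps: "x \<in> L \<Longrightarrow> f x \<in> M"
    and additive: "x \<in> L \<Longrightarrow> y \<in> L \<Longrightarrow> f (x + y) = f x + f y"
begin

lemma frag_hom:
  "frag_extend (\<lambda>p. frag_of (f (fst p), r * snd p)) \<in> hom (tensor_rat_free L) (tensor_rat_free M)"
proof (rule homI)
  fix z assume "z \<in> carrier (tensor_rat_free L)"
  then show "frag_extend (\<lambda>p. frag_of (f (fst p), r * snd p)) z \<in> carrier (tensor_rat_free M)"
    using maps keys_frag_extend[of "\<lambda>p. frag_of (f (fst p), r * snd p)" z]
    by (fastforce simp: tensor_rat_free_def)
qed (simp add: tensor_rat_free_def frag_extend_add)

text \<open>Generating relations go to generating relations: additivity of \<open>f\<close> serves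
  those in the first factor, distributivity of multiplication by \<open>r\<close> those in the
  second.\<close>

lemma frag_kernel:
  assumes z: "z \<in> tensor_rat_kernel L"
  shows "frag_extend (\<lambda>p. frag_of (f (fst p), r * snd p)) z \<in> tensor_rat_kernel M"
proof -
  let ?F = "frag_extend (\<lambda>p. frag_of (f (fst p), r * snd p))"
  interpret group_hom "tensor_rat_free L" "tensor_rat_free M" ?F
    using frag_hom[of r] by (auto simp: group_hom_def group_hom_axioms_def tensor_rat_free_def)
  have "?F ` tensor_rat_relations L \<subseteq> tensor_rat_relations M"
  proof (rule image_subsetI)
    fix w assume "w \<in> tensor_rat_relations L"
    then consider x y q where "w = frag_of (x + y, q) - frag_of (x, q) - frag_of (y, q)" "x \<in> L" "y \<in> L"
      | x q s where "w = frag_of (x, q + s) - frag_of (x, q) - frag_of (x, s)" "x \<in> L"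
      unfolding tensor_rat_relations_def by blast
    then show "?F w \<in> tensor_rat_relations M"
    proof cases
      case 1
      then have "?F w = frag_of (f x + f y, r * q) - frag_of (f x, r * q) - frag_of (f y, r * q)"
        using additive by (simp add: frag_extend_diff)
      then show ?thesis using 1 maps unfolding tensor_rat_relations_def by blast
    next
      case 2
      then have "?F w = frag_of (f x, r * q + r * s) - frag_of (f x, r * q) - frag_of (f x, r * s)"
        by (simp add: frag_extend_diff distrib_left)
      then show ?thesis using 2 maps unfolding tensor_rat_relations_def by blast
    qed
  qed
  then have "generate (tensor_rat_free M) (?F ` tensor_rat_relations L) \<subseteq> tensor_rat_kernel M"
    unfolding tensor_rat_kernel_def by (rule H.mono_generate)
  then show ?thesis
    using z generate_img[OF tensor_rat_relations_closed[OF L_add]]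
    unfolding tensor_rat_kernel_def by blast
qed

text \<open>By \<open>frag_kernel\<close> all representatives of the coset have images in one coset,
  so the union defining \<open>tensor_rat_map\<close> collapses.\<close>

lemma tensor_rat_map_coset:
  assumes z: "z \<in> carrier (tensor_rat_free L)"
  shows "tensor_rat_map L M r f (tensor_rat_kernel L #>\<^bsub>tensor_rat_free L\<^esub> z) =
    tensor_rat_kernel M #>\<^bsub>tensor_rat_free M\<^esub> frag_extend (\<lambda>p. frag_of (f (fst p), r * snd p)) z"
proof -
  let ?F = "frag_extend (\<lambda>p. frag_of (f (fst p), r * snd p))"
  interpret G: group "tensor_rat_free M" by (simp add: tensor_rat_free_def)
  note K = tensor_rat_kernel_subgroup[of L, OF L_add] tensor_rat_kernel_subgroup[of M, OF M_add]
  have Fz: "?F z \<in> carrier (tensor_rat_free M)"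
    using frag_hom z by (rule hom_in_carrier)
  have "tensor_rat_kernel M #>\<^bsub>tensor_rat_free M\<^esub> ?F (k + z) =
      tensor_rat_kernel M #>\<^bsub>tensor_rat_free M\<^esub> ?F z" if "k \<in> tensor_rat_kernel L" for k
  proof -
    have "?F (k + z) \<in> tensor_rat_kernel M #>\<^bsub>tensor_rat_free M\<^esub> ?F z"
      using frag_kernel[OF that, of r]
      by (auto simp: r_coset_def tensor_rat_free_def frag_extend_add)
    then show ?thesis
      using G.repr_independence[OF _ Fz K(2)] by simp
  qed
  moreover have "tensor_rat_kernel L #>\<^bsub>tensor_rat_free L\<^esub> z = (\<lambda>k. k + z) ` tensor_rat_kernel L"
    by (auto simp: r_coset_def tensor_rat_free_def)
  moreover have "tensor_rat_kernel L \<noteq> {}" using subgroup.one_closed[OF K(1)] by blast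
  ultimately show ?thesis
    by (simp add: tensor_rat_map_def)
qed

lemma tensor_rat_map_closed:
  "t \<in> carrier (tensor_rat L) \<Longrightarrow> tensor_rat_map L M r f t \<in> carrier (tensor_rat M)"
  using hom_in_carrier[OF frag_hom] by (auto simp: carrier_tensor_rat tensor_rat_map_coset)

lemma tensor_rat_map_hom: "tensor_rat_map L M r f \<in> hom (tensor_rat L) (tensor_rat M)"
proof (rule homI)
  interpret NL: normal "tensor_rat_kernel L" "tensor_rat_free L"
    by (rule tensor_rat_kernel_normal[OF L_add])
  interpret NM: normal "tensor_rat_kernel M" "tensor_rat_free M"
    by (rule tensor_rat_kernel_normal[OF M_add])
  fix s t assume "s \<in> carrier (tensor_rat L)" "t \<in> carrier (tensor_rat L)"
  then obtain y z where yz: "y \<in> carrier (tensor_rat_free L)" "z \<in> carrier (tensor_rat_free L)"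
    "s = tensor_rat_kernel L #>\<^bsub>tensor_rat_free L\<^esub> y" "t = tensor_rat_kernel L #>\<^bsub>tensor_rat_free L\<^esub> z"
    by (auto simp: carrier_tensor_rat)
  note F = hom_in_carrier[OF frag_hom yz(1)] hom_in_carrier[OF frag_hom yz(2)]
    hom_mult[OF frag_hom yz(1,2)] NL.m_closed[OF yz(1,2)]
  show "tensor_rat_map L M r f (s \<otimes>\<^bsub>tensor_rat L\<^esub> t) =
      tensor_rat_map L M r f s \<otimes>\<^bsub>tensor_rat M\<^esub> tensor_rat_map L M r f t"
    by (simp only: mult_tensor_rat yz(3,4) NL.rcos_sum[OF yz(1,2)] tensor_rat_map_coset[OF yz(1)]
        tensor_rat_map_coset[OF yz(2)] tensor_rat_map_coset[OF F(4)] NM.rcos_sum[OF F(1,2)] F(3))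
qed (rule tensor_rat_map_closed)

end

lemma tensor_rat_map_compose:
  assumes "additive_between L M f" "additive_between M N g" "t \<in> carrier (tensor_rat L)"
  shows "tensor_rat_map M N s g (tensor_rat_map L M r f t) = tensor_rat_map L N (s * r) (\<lambda>x. g (f x)) t"
proof -
  interpret f: additive_between L M f by fact
  interpret g: additive_between M N g by fact
  interpret gf: additive_between L N "\<lambda>x. g (f x)"
    by standard (simp_all add: f.L_add g.M_add f.maps g.maps f.additive g.additive)
  obtain z where z: "z \<in> carrier (tensor_rat_free L)"
    "t = tensor_rat_kernel L #>\<^bsub>tensor_rat_free L\<^esub> z"
    using assms(3) by (auto simp: carrier_tensor_rat)
  have "frag_extend (\<lambda>p. frag_of (g (fst p), s * snd p)) (frag_extend (\<lambda>p. frag_of (f (fst p), r * snd p)) z)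
      = frag_extend (\<lambda>p. frag_of (g (f (fst p)), s * r * snd p)) z"
    using frag_extend_compose[of "\<lambda>p. frag_of (g (fst p), s * snd p)" "\<lambda>p. (f (fst p), r * snd p)" z]
    by (simp add: o_def mult.assoc)
  then show ?thesis
    using z hom_in_carrier[OF f.frag_hom]
    by (simp add: f.tensor_rat_map_coset g.tensor_rat_map_coset gf.tensor_rat_map_coset)
qed

text \<open>On pure tensors, 2x \<otimes> q/2 = x \<otimes> q. This is what makes a map invertible
  over the rationals once it is invertible up to doubling.\<close>

lemma tensor_rat_map_double_half:
  assumes add: "\<And>x y. x \<in> L \<Longrightarrow> y \<in> L \<Longrightarrow> x + y \<in> L" and t: "t \<in> carrier (tensor_rat L)"
  shows "tensor_rat_map L L (1/2) (\<lambda>x. x + x) t = t"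
proof -
  interpret additive_between L L "\<lambda>x. x + x"
    by standard (auto simp: add)
  interpret normal "tensor_rat_kernel L" "tensor_rat_free L"
    by (rule tensor_rat_kernel_normal[OF add])
  let ?F = "frag_extend (\<lambda>p. frag_of (fst p + fst p, 1/2 * snd p))"
  let ?K = "tensor_rat_kernel L"
  obtain z where z: "z \<in> carrier (tensor_rat_free L)" "t = ?K #>\<^bsub>tensor_rat_free L\<^esub> z"
    using t by (auto simp: carrier_tensor_rat)
  have minus: "a - b \<in> ?K" if "a \<in> ?K" "b \<in> ?K" for a b
  proof -
    have "a \<otimes>\<^bsub>tensor_rat_free L\<^esub> inv\<^bsub>tensor_rat_free L\<^esub> b \<in> ?K"
      using that by simp
    moreover have "b \<in> carrier (tensor_rat_free L)"
      using that subset by blast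
    ultimately show ?thesis by (simp add: tensor_rat_free_def)
  qed
  have relL: "frag_of (x + y, q) - frag_of (x, q) - frag_of (y, q) \<in> ?K" if "x \<in> L" "y \<in> L" for x y q
    unfolding tensor_rat_kernel_def tensor_rat_relations_def
    using that by (intro generate.incl) blast
  have relR: "frag_of (x, q + r) - frag_of (x, q) - frag_of (x, r) \<in> ?K" if "x \<in> L" for x q r
    unfolding tensor_rat_kernel_def tensor_rat_relations_def
    using that by (intro generate.incl) blast
  have "Poly_Mapping.keys z \<subseteq> L \<times> UNIV"
    using z(1) by (simp add: tensor_rat_free_def)
  then have diff: "?F z - z \<in> ?K"
  proof (induction z rule: frag_induction)
    case zero
    have "\<one>\<^bsub>tensor_rat_free L\<^esub> \<in> ?K" by (rule subgroup.one_closed[OF subgroup_axioms])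
    then show ?case by (simp add: tensor_rat_free_def)
  next
    case (one p)
    obtain x q where p: "p = (x, q)" "x \<in> L" using one by auto
    \<comment> \<open>Both 2x \<otimes> q/2 and x \<otimes> q equal twice x \<otimes> q/2, the
      former by additivity in the first factor and the latter by additivity in the second;
      subtracting the two relations compares them.\<close>
    have "frag_of (x + x, q/2) - frag_of (x, q/2) - frag_of (x, q/2) \<in> ?K"
      by (rule relL[OF p(2) p(2)])
    moreover have "frag_of (x, q/2 + q/2) - frag_of (x, q/2) - frag_of (x, q/2) \<in> ?K"
      by (rule relR[OF p(2)])
    ultimately have "(frag_of (x + x, q/2) - frag_of (x, q/2) - frag_of (x, q/2)) -
        (frag_of (x, q/2 + q/2) - frag_of (x, q/2) - frag_of (x, q/2)) \<in> ?K"
      by (rule minus)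
    then show ?case by (simp add: p)
  next
    case (diff a b)
    have "?F (a - b) - (a - b) = (?F a - a) - (?F b - b)"
      by (simp add: frag_extend_diff)
    then show ?case using minus[OF diff] by (simp only:)
  qed
  have "?F z \<in> ?K #>\<^bsub>tensor_rat_free L\<^esub> z"
    using rcosI[OF diff subset z(1)] by (simp only: mult_tensor_rat_free diff_add_cancel)
  then show ?thesis
    by (simp only: z(2) tensor_rat_map_coset[OF z(1)] repr_independence[OF _ z(1) subgroup_axioms, symmetric])
qed

lemma additive_between_compose:
  assumes "additive_between L M f" "additive_between M N g"
  shows "additive_between L N (\<lambda>x. g (f x))"
  using assms unfolding additive_between_def by metis

text \<open>The maps f \<otimes> 1 and g \<otimes> 1/2 are mutually inverse: both composites double
  the first factor and halve the second.\<close>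

lemma rationally_isomorphicI:
  fixes L M :: "(complex^'n) set"
  assumes f: "additive_between L M f" and g: "additive_between M L g"
    and gf: "\<And>x. x \<in> L \<Longrightarrow> g (f x) = x + x" and fg: "\<And>y. y \<in> M \<Longrightarrow> f (g y) = y + y"
    and L: "\<And>A x. A \<in> H \<Longrightarrow> x \<in> L \<Longrightarrow> A *v x \<in> L" and M: "\<And>A x. A \<in> H \<Longrightarrow> x \<in> M \<Longrightarrow> A *v x \<in> M"
    and equiv: "\<And>A x. A \<in> H \<Longrightarrow> x \<in> L \<Longrightarrow> f (A *v x) = A *v f x"
  shows "rationally_isomorphic H L M"
proof -
  interpret f: additive_between L M f by fact
  interpret g: additive_between M L g by fact
  \<comment> \<open>The induced map sees only the values on \<open>K\<close>. This matters because
    the composites agree with doubling, and \<open>f\<close> commutes with the action, only on the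
    given subgroups.\<close>
  have cong: "tensor_rat_map K N r h t = tensor_rat_map K N r h' t"
    if h: "additive_between K N h" "additive_between K N h'" "\<And>x. x \<in> K \<Longrightarrow> h x = h' x"
      and t: "t \<in> carrier (tensor_rat K)" for K N :: "(complex^'n) set" and r h h' t
  proof -
    obtain z where z: "z \<in> carrier (tensor_rat_free K)"
      "t = tensor_rat_kernel K #>\<^bsub>tensor_rat_free K\<^esub> z"
      using t by (auto simp: carrier_tensor_rat)
    have "frag_extend (\<lambda>p. frag_of (h (fst p), r * snd p)) z = frag_extend (\<lambda>p. frag_of (h' (fst p), r * snd p)) z"
      using z(1) h(3) by (intro frag_extend_eq) (auto simp: tensor_rat_free_def)
    then show ?thesis
      by (simp only: z(2) additive_between.tensor_rat_map_coset[OF h(1) z(1)]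
          additive_between.tensor_rat_map_coset[OF h(2) z(1)])
  qed
  let ?f = "tensor_rat_map L M 1 f" and ?g = "tensor_rat_map M L (1/2) g"
  have dbl: "additive_between L L (\<lambda>x. x + x)" "additive_between M M (\<lambda>x. x + x)"
    unfolding additive_between_def using f.L_add f.M_add by (auto simp only: ac_simps)
  have "?g (?f t) = t" if "t \<in> carrier (tensor_rat L)" for t
    using tensor_rat_map_compose[OF f g that]
      cong[OF additive_between_compose[OF f g] dbl(1) gf that, of "1/2"]
      tensor_rat_map_double_half[OF f.L_add that] by (simp only: mult_1_right)
  moreover have "?f (?g t) = t" if "t \<in> carrier (tensor_rat M)" for t
    using tensor_rat_map_compose[OF g f that]
      cong[OF additive_between_compose[OF g f] dbl(2) fg that, of "1/2"]
      tensor_rat_map_double_half[OF f.M_add that] by (simp only: mult_1_left)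
  ultimately have "bij_betw ?f (carrier (tensor_rat L)) (carrier (tensor_rat M))"
    using f.tensor_rat_map_closed g.tensor_rat_map_closed
    by (intro bij_betwI[where g = ?g]) auto
  then have "?f \<in> iso (tensor_rat L) (tensor_rat M)"
    using f.tensor_rat_map_hom by (simp add: iso_def)
  moreover have "?f (tensor_rat_act L r ((*v) A) t) = tensor_rat_act M r ((*v) A) (?f t)"
    if A: "A \<in> H" and t: "t \<in> carrier (tensor_rat L)" for r A t
  proof -
    have AL: "additive_between L L ((*v) A)" and AM: "additive_between M M ((*v) A)"
      using A L M by (auto simp: additive_between_def f.L_add f.M_add matrix_vector_right_distrib)
    show ?thesis
      using tensor_rat_map_compose[OF AL f t, of 1 r] tensor_rat_map_compose[OF f AM t, of r 1]
        cong[OF additive_between_compose[OF AL f] additive_between_compose[OF f AM] equiv[OF A] t, of r]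
      by (simp only: tensor_rat_act_eq_map mult_1_left mult_1_right)
  qed
  ultimately show ?thesis
    unfolding rationally_isomorphic_def by blast
qed

section \<open>Lattices in the plane\<close>

text \<open>Take \<open>u\<close> a shortest nonzero vector and \<open>v\<close> a shortest one off
  the real line of \<open>u\<close>; rounding real coordinates leaves a remainder too short to be
  nonzero. Up to sign \<open>Im (u * cnj v)\<close> is the determinant of \<open>u\<close> and
  \<open>v\<close>, so its nonvanishing is linear independence over the reals.\<close>

lemma planar_lattice_basis:
  fixes G :: "complex set"
  assumes minus: "\<And>x y. x \<in> G \<Longrightarrow> y \<in> G \<Longrightarrow> x - y \<in> G"
    and disc: "e > 0" "\<And>x. x \<in> G \<Longrightarrow> norm x < e \<Longrightarrow> x = 0"
    and w: "w\<^sub>1 \<in> G" "w\<^sub>2 \<in> G" "Im (w\<^sub>1 * cnj w\<^sub>2) \<noteq> 0"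
  obtains u v where "u \<in> G" "v \<in> G" "Im (u * cnj v) \<noteq> 0"
    "\<And>z. z \<in> G \<Longrightarrow> \<exists>a b :: int. z = of_int a * u + of_int b * v"
proof -
  have "uniform_discrete G"
    unfolding uniform_discrete_def
  proof (intro exI conjI ballI impI)
    fix x y assume "x \<in> G" "y \<in> G" "dist x y < e"
    then show "x = y" using disc(2)[OF minus, of x y] by (simp add: dist_norm)
  qed (rule disc(1))
  then have fin: "finite (G \<inter> cball 0 r)" for r
    using uniform_discrete_finite_iff[of "G \<inter> cball 0 r"] uniform_discrete_subset[of G "G \<inter> cball 0 r"]
    by (auto intro: bounded_subset[OF bounded_cball[of 0 r]])
  have shortest: "\<exists>u\<in>G. Q u \<and> (\<forall>z\<in>G. Q z \<longrightarrow> norm u \<le> norm z)" if "w \<in> G" "Q w" for Q w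
  proof -
    let ?S = "{z \<in> G \<inter> cball 0 (norm w). Q z}"
    have "finite ?S" "?S \<noteq> {}" using that by (auto intro: finite_subset[OF _ fin[of "norm w"]])
    then obtain u where u: "is_arg_min norm (\<lambda>z. z \<in> ?S) u"
      using ex_is_arg_min_if_finite[of ?S norm] by blast
    then have "\<forall>z\<in>?S. norm u \<le> norm z" "u \<in> ?S"
      by (auto simp: is_arg_min_linorder)
    then show ?thesis
      using linear[of "norm _" "norm w"] by (intro bexI[of _ u]) force+
  qed
  obtain u where u: "u \<in> G" "u \<noteq> 0" "\<And>z. z \<in> G \<Longrightarrow> z \<noteq> 0 \<Longrightarrow> norm u \<le> norm z"
    using shortest[OF w(1), of "\<lambda>z. z \<noteq> 0"] w(3) by (metis complex_cnj_zero mult_zero_left zero_complex.sel(2))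
  \<comment> \<open>Otherwise \<open>w\<^sub>1\<close> and \<open>w\<^sub>2\<close> both lie on the
    real line of the nonzero vector \<open>u\<close> and are parallel.\<close>
  have "\<exists>w\<in>G. Im (u * cnj w) \<noteq> 0"
  proof (rule ccontr)
    assume *: "\<not> ?thesis"
    have "Re u * (Re w\<^sub>1 * Im w\<^sub>2 - Im w\<^sub>1 * Re w\<^sub>2) = 0" "Im u * (Re w\<^sub>1 * Im w\<^sub>2 - Im w\<^sub>1 * Re w\<^sub>2) = 0"
    proof -
      have "Im u * Re w\<^sub>1 = Re u * Im w\<^sub>1" "Im u * Re w\<^sub>2 = Re u * Im w\<^sub>2"
        using * w by auto
      then show "Re u * (Re w\<^sub>1 * Im w\<^sub>2 - Im w\<^sub>1 * Re w\<^sub>2) = 0" "Im u * (Re w\<^sub>1 * Im w\<^sub>2 - Im w\<^sub>1 * Re w\<^sub>2) = 0"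
        by algebra+
    qed
    then show False using w(3) u(2) by (auto simp: complex_eq_iff)
  qed
  then obtain v where v: "v \<in> G" "Im (u * cnj v) \<noteq> 0"
    "\<And>z. z \<in> G \<Longrightarrow> Im (u * cnj z) \<noteq> 0 \<Longrightarrow> norm v \<le> norm z"
    using shortest[of _ "\<lambda>w. Im (u * cnj w) \<noteq> 0"] by metis
  have mult: "of_int a * x \<in> G" if "x \<in> G" for a x
  proof -
    have "0 \<in> G" using minus[OF w(1) w(1)] by simp
    then show ?thesis
    proof (induction a rule: int_induct[where k = 0])
      case (step1 i)
      have "of_int (i + 1) * x = of_int i * x - (0 - x)" by (simp add: algebra_simps)
      then show ?case using minus step1 that by metis
    next
      case (step2 i)
      have "of_int (i - 1) * x = of_int i * x - x" by (simp add: algebra_simps)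
      then show ?case using minus step2 that by metis
    qed auto
  qed
  show thesis
  proof (rule that[OF u(1) v(1,2)])
    fix z assume z: "z \<in> G"
    \<comment> \<open>Cramer's rule: \<alpha> and \<beta> are the real coordinates of
      \<open>z\<close> with respect to \<open>u\<close> and \<open>v\<close>.\<close>
    define d where "d = Im (u * cnj v)"
    define \<alpha> where "\<alpha> = Im (z * cnj v) / d"
    define \<beta> where "\<beta> = Im (u * cnj z) / d"
    have d: "d \<noteq> 0" using v by (simp add: d_def)
    have zab: "z = of_real \<alpha> * u + of_real \<beta> * v"
    proof -
      have "of_real d * z = of_real (Im (z * cnj v)) * u + of_real (Im (u * cnj z)) * v"
        by (simp add: complex_eq_iff d_def algebra_simps)
      then show ?thesis using d unfolding \<alpha>_def \<beta>_def
        by (simp del: times_complex.sel cnj.sel add: field_simps)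
    qed
    define a where "a = \<alpha> - of_int (round \<alpha>)"
    define b where "b = \<beta> - of_int (round \<beta>)"
    define y where "y = z - of_int (round \<alpha>) * u - of_int (round \<beta>) * v"
    have yG: "y \<in> G" unfolding y_def by (intro minus z mult u v)
    have y: "y = of_real a * u + of_real b * v"
      by (subst y_def, subst zab) (simp add: a_def b_def algebra_simps)
    have ab: "\<bar>a\<bar> \<le> 1/2" "\<bar>b\<bar> \<le> 1/2"
      unfolding a_def b_def using of_int_round_abs_le[of \<alpha>] of_int_round_abs_le[of \<beta>] by linarith+
    have v0: "v \<noteq> 0" using v by auto
    have uv: "norm u \<le> norm v" using u(3)[OF v(1) v0] .
    \<comment> \<open>If b \<noteq> 0, then \<open>y\<close> is off the line of \<open>u\<close>, so
      it is at least as long as \<open>v\<close>. Coordinates of size at most 1/2 then force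
      equality in the triangle inequality, making the nonzero vectors \<open>a u\<close> and
      \<open>b v\<close> parallel.\<close>
    have "b = 0"
    proof (rule ccontr)
      assume b: "b \<noteq> 0"
      have im: "Im (u * cnj y) = b * d" by (simp add: y d_def algebra_simps)
      have le: "norm v \<le> norm y" using v(3)[OF yG] im b d by (metis mult_eq_0_iff)
      have tri: "norm y \<le> \<bar>a\<bar> * norm u + \<bar>b\<bar> * norm v"
        unfolding y by (rule order.trans[OF norm_triangle_ineq]) (simp add: norm_mult)
      have au: "\<bar>a\<bar> * norm u \<le> 1/2 * norm v" using ab uv by (intro mult_mono) auto
      have bv: "\<bar>b\<bar> * norm v \<le> 1/2 * norm v" using ab by (intro mult_mono) auto
      have eq: "norm (of_real a * u + of_real b * v) = norm (of_real a * u) + norm (of_real b * v)"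
        using le tri au bv y by (simp add: norm_mult)
      have au': "\<bar>a\<bar> * norm u = 1/2 * norm v" using le tri au bv by linarith
      then have a: "a \<noteq> 0" using v0 by auto
      have "norm (of_real a * u) *\<^sub>R (of_real b * v) = norm (of_real b * v) *\<^sub>R (of_real a * u)"
        using eq by (simp only: norm_triangle_eq)
      then have "Im (u * cnj (norm (of_real a * u) *\<^sub>R (of_real b * v))) =
          Im (u * cnj (norm (of_real b * v) *\<^sub>R (of_real a * u)))" by simp
      also have "\<dots> = 0" by (simp add: algebra_simps)
      finally have "norm (of_real a * u) * b * d = 0" by (simp add: d_def algebra_simps)
      then show False using a b d u by (simp add: norm_mult)
    qed
    moreover have "a = 0"
    proof (rule ccontr)
      assume a: "a \<noteq> 0"
      then have "norm u \<le> norm y" using u yG \<open>b = 0\<close> y by auto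
      also have "norm y \<le> 1/2 * norm u" using mult_right_mono[OF ab(1), of "norm u"] \<open>b = 0\<close> y
        by (simp add: norm_mult)
      finally show False using u by simp
    qed
    ultimately have "z = of_int (round \<alpha>) * u + of_int (round \<beta>) * v"
      using y by (simp add: y_def algebra_simps)
    then show "\<exists>a b :: int. z = of_int a * u + of_int b * v" by blast
  qed
qed

text \<open>Over \<open>G/2G\<close>, a plane over the field with two elements, \<open>H\<close> lies in the kernel of a nonzero functional;
  the basis is chosen so that this functional is the second coordinate.\<close>

lemma planar_lattice_adapted_basis:
  fixes G H :: "complex set"
  assumes minus: "\<And>x y. x \<in> G \<Longrightarrow> y \<in> G \<Longrightarrow> x - y \<in> G"
    and disc: "e > 0" "\<And>x. x \<in> G \<Longrightarrow> norm x < e \<Longrightarrow> x = 0"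
    and H_minus: "\<And>x y. x \<in> H \<Longrightarrow> y \<in> H \<Longrightarrow> x - y \<in> H"
    and double: "\<And>x. x \<in> G \<Longrightarrow> 2 * x \<in> H"
    and proper: "H \<subset> G"
    and w: "w\<^sub>1 \<in> G" "w\<^sub>2 \<in> G" "Im (w\<^sub>1 * cnj w\<^sub>2) \<noteq> 0"
  obtains u v where "u \<in> G" "v \<in> G" "Im (u * cnj v) \<noteq> 0"
    "\<And>z. z \<in> H \<Longrightarrow> \<exists>a b :: int. z = of_int a * u + 2 * of_int b * v"
proof -
  obtain u v where uv: "u \<in> G" "v \<in> G" "Im (u * cnj v) \<noteq> 0"
    and basis: "\<And>z. z \<in> G \<Longrightarrow> \<exists>a b :: int. z = of_int a * u + of_int b * v"
    using planar_lattice_basis[OF minus disc w] by blast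
  have G0: "0 \<in> G" using minus[OF w(1) w(1)] by simp
  then have H0: "0 \<in> H" using double[of 0] by simp
  have G_add: "x + y \<in> G" if "x \<in> G" "y \<in> G" for x y
    using minus[OF that(1) minus[OF G0 that(2)]] by simp
  have H_add: "x + y \<in> H" if "x \<in> H" "y \<in> H" for x y
    using H_minus[OF that(1) H_minus[OF H0 that(2)]] by simp
  have H_mult: "of_int a * x \<in> H" if "x \<in> H" for a x
  proof (induction a rule: int_induct[where k = 0])
    case (step1 i)
    then show ?case using H_add[OF step1(2) that] by (simp add: algebra_simps)
  next
    case (step2 i)
    then show ?case using H_minus[OF step2(2) that] by (simp add: algebra_simps)
  qed (simp add: H0)
  have even_mult: "of_int a * x \<in> H" if x: "x \<in> G" and a: "even a" for a x
  proof -
    obtain k where "a = 2 * k" using a by auto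
    then show ?thesis using H_mult[OF double[OF x], of k] by (simp add: mult_ac)
  qed
  \<comment> \<open>Since \<open>H\<close> contains 2G, membership in \<open>H\<close> can be tested
    modulo 2G.\<close>
  have parity: "of_int a * x \<in> H \<longleftrightarrow> even a \<or> x \<in> H" if "x \<in> G" for a x
  proof (cases "even a")
    case False
    then have "of_int (a - 1) * x \<in> H" using even_mult[OF that, of "a - 1"] by simp
    then have "of_int a * x \<in> H \<longleftrightarrow> x \<in> H"
      using H_add[of "of_int (a - 1) * x" x] H_minus[of "of_int a * x" "of_int (a - 1) * x"]
      by (auto simp: algebra_simps)
    then show ?thesis using False by simp
  qed (simp add: even_mult that)
  have coset: "x + y \<in> H \<longleftrightarrow> y \<in> H" if "x \<in> H" for x y
    using that H_add[of x y] H_minus[of "x + y" x] by auto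
  have not_both: "\<not> (u \<in> H \<and> v \<in> H)"
  proof
    assume "u \<in> H \<and> v \<in> H"
    then have "z \<in> H" if "z \<in> G" for z
      using basis[OF that] H_add H_mult by metis
    then show False using proper by blast
  qed
  \<comment> \<open>Being proper, \<open>H\<close> contains at most one of the three nonzero classes
    modulo 2G. That class is made the first basis vector; the last case also covers H = 2G.\<close>
  consider "u + v \<in> H" | "v \<in> H" | "u + v \<notin> H" "v \<notin> H" by blast
  then show thesis
  proof cases
    case 1
    show thesis
    proof (rule that[of "u + v" v])
      fix z assume "z \<in> H"
      moreover from this obtain a b :: int where z: "z = of_int a * u + of_int b * v"
        using basis proper by blast
      then have z': "z = of_int a * (u + v) + of_int (b - a) * v" by (simp add: algebra_simps)
      ultimately have "of_int (b - a) * v \<in> H"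
        using coset[OF H_mult[OF 1, of a]] by simp
      moreover have "v \<notin> H" using 1 not_both coset[of v u] by (auto simp: add.commute)
      ultimately obtain k where "b - a = 2 * k" using parity[OF uv(2)] by blast
      then have "z = of_int a * (u + v) + 2 * of_int k * v" unfolding z' by simp
      then show "\<exists>a b :: int. z = of_int a * (u + v) + 2 * of_int b * v" by blast
    qed (use uv G_add in \<open>auto simp: algebra_simps\<close>)
  next
    case 2
    show thesis
    proof (rule that[of v u])
      fix z assume "z \<in> H"
      moreover from this obtain a b :: int where z: "z = of_int a * u + of_int b * v"
        using basis proper by blast
      then have z': "z = of_int b * v + of_int a * u" by (simp add: algebra_simps)
      ultimately have "of_int a * u \<in> H"
        using coset[OF H_mult[OF 2, of b]] by simp
      then obtain k where "a = 2 * k" using parity[OF uv(1)] 2 not_both by blast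
      then have "z = of_int b * v + 2 * of_int k * u" unfolding z' by simp
      then show "\<exists>a b :: int. z = of_int a * v + 2 * of_int b * u" by blast
    qed (use uv in \<open>auto simp: algebra_simps\<close>)
  next
    case 3
    show thesis
    proof (rule that[of u v])
      fix z assume zH: "z \<in> H"
      then obtain a b :: int where z: "z = of_int a * u + of_int b * v"
        using basis proper by blast
      \<comment> \<open>For odd \<open>b\<close> the vector \<open>z\<close> is congruent modulo 2G
        to \<open>v\<close> or to \<open>u + v\<close>, according to the parity of \<open>a\<close>,
        and neither is in \<open>H\<close>.\<close>
      have "even b"
      proof (rule ccontr)
        assume b: "odd b"
        have "z = of_int (b - 1) * v + (of_int a * u + v)" using z by (simp add: algebra_simps)
        then have av: "of_int a * u + v \<in> H"
          using zH coset[OF even_mult[OF uv(2), of "b - 1"]] b by simp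
        show False
        proof (cases "even a")
          case True
          then show ?thesis using av coset[OF even_mult[OF uv(1)]] 3 by simp
        next
          case False
          have "of_int a * u + v = of_int (a - 1) * u + (u + v)" by (simp add: algebra_simps)
          moreover have "of_int (a - 1) * u \<in> H" using even_mult[OF uv(1), of "a - 1"] False by simp
          ultimately show ?thesis using av coset[of "of_int (a - 1) * u" "u + v"] 3 by metis
        qed
      qed
      then obtain k where "b = 2 * k" by blast
      then show "\<exists>a b :: int. z = of_int a * u + 2 * of_int b * v" using z by auto
    qed (use uv in auto)
  qed
qed

section \<open>Simultaneous diagonalisation of involutions\<close>

text \<open>A further involution \<open>A\<close> splits a common eigenvector \<open>x\<close> into
  the halves of \<open>x + A x\<close> and \<open>x - A x\<close>; commutation keeps both of them
  eigenvectors of the earlier matrices.\<close>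

lemma common_eigenvectors_span:
  fixes S :: "('a::field_char_0^'n^'n) set"
  assumes "finite S" "\<And>A. A \<in> S \<Longrightarrow> A ** A = mat 1"
    and "\<And>A B. A \<in> S \<Longrightarrow> B \<in> S \<Longrightarrow> A ** B = B ** A"
  shows "vec.span {x. \<forall>A\<in>S. A *v x = x \<or> A *v x = - x} = UNIV"
  using assms
proof (induction S rule: finite_induct)
  case (insert A S)
  let ?E = "\<lambda>S. {x::'a^'n. \<forall>A\<in>S. A *v x = x \<or> A *v x = - x}"
  have "x \<in> vec.span (?E (insert A S))" if x: "x \<in> ?E S" for x
  proof -
    have AA: "A *v (A *v x) = x"
      using insert.prems(1)[of A] by (simp add: matrix_vector_mul_assoc)
    have comm: "B *v (A *v x) = A *v (B *v x)" if "B \<in> S" for B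
      using insert.prems(2)[of A B] that by (simp add: matrix_vector_mul_assoc)
    have "x + A *v x \<in> ?E (insert A S)" "x - A *v x \<in> ?E (insert A S)"
      using x AA comm
      by (auto simp: matrix_vector_right_distrib matrix_vector_mult_diff_distrib
          vec.neg algebra_simps)
    then have "(1/2) *s (x + A *v x) + (1/2) *s (x - A *v x) \<in> vec.span (?E (insert A S))"
      by (intro vec.span_add vec.span_scale vec.span_base)
    moreover have "(1/2) *s (x + A *v x) + (1/2) *s (x - A *v x) = x"
      by (simp add: vec_eq_iff field_simps)
    ultimately show ?thesis by simp
  qed
  then have "vec.span (?E S) \<subseteq> vec.span (?E (insert A S))"
    by (intro vec.span_minimal) auto
  then show ?case using insert by auto
qed simp

text \<open>A maximal independent set of common eigenvectors spans the space, hence has as many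
  members as there are indices and can serve as the columns of \<open>P\<close>.\<close>

lemma simultaneous_diagonalization:
  fixes S :: "('a::field_char_0^'n^'n) set"
  assumes "finite S" "\<And>A. A \<in> S \<Longrightarrow> A ** A = mat 1"
    and "\<And>A B. A \<in> S \<Longrightarrow> B \<in> S \<Longrightarrow> A ** B = B ** A"
  obtains P :: "'a^'n^'n" where "invertible P"
    "\<And>A i. A \<in> S \<Longrightarrow> A *v column i P = column i P \<or> A *v column i P = - column i P"
proof -
  let ?E = "{x. \<forall>A\<in>S. A *v x = x \<or> A *v x = - x}"
  obtain B where B: "B \<subseteq> ?E" "vec.independent B" "?E \<subseteq> vec.span B"
    by (rule vec.maximal_independent_subset)
  have "vec.span ?E \<subseteq> vec.span B"
    using B(3) by (rule vec.span_minimal) simp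
  then have span: "vec.span B = UNIV"
    using common_eigenvectors_span[OF assms] by auto
  have "card B = CARD('n)"
    using vec.dim_eq_card[of B UNIV] B(2) span by (simp del: vec.dim_UNIV add: vec_dim_card)
  moreover have "finite B" by (rule vec.finiteI_independent[OF B(2)])
  ultimately obtain f where f: "bij_betw f (UNIV :: 'n set) B"
    using finite_same_card_bij[of "UNIV :: 'n set" B] by auto
  define P where "P = (\<chi> i j. f j $ i)"
  have col: "column j P = f j" for j
    by (simp add: column_def P_def vec_eq_iff)
  then have "columns P = B"
    using f by (auto simp: columns_def bij_betw_def)
  then have "invertible P"
    using span matrix_right_invertible_span_columns[of P] by (simp add: invertible_right_inverse)
  moreover have "f i \<in> ?E" for i
    using f B(1) by (auto simp: bij_betw_def)
  ultimately show thesis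
    using that[of P] unfolding col by blast
qed

section \<open>Complex Hantzsche-Wendt groups in diagonal coordinates\<close>

lemma product_integer_mod_group_2:
  fixes f g :: "nat \<Rightarrow> int"
  assumes "f \<in> carrier (product_group I (\<lambda>_. integer_mod_group 2))"
    and "g \<in> carrier (product_group I (\<lambda>_. integer_mod_group 2))"
  shows "f \<otimes>\<^bsub>product_group I (\<lambda>_. integer_mod_group 2)\<^esub> f = \<one>\<^bsub>product_group I (\<lambda>_. integer_mod_group 2)\<^esub>"
    and "f \<otimes>\<^bsub>product_group I (\<lambda>_. integer_mod_group 2)\<^esub> g = g \<otimes>\<^bsub>product_group I (\<lambda>_. integer_mod_group 2)\<^esub> f"
  by (auto simp: fun_eq_iff restrict_def add.commute integer_mod_group_def)

text \<open>The images of the balls of integral radius about 0 are an open cover of the orbit space,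
  and a finite subcover has a largest radius.\<close>

lemma orbit_space_compact_imp_bounded_representatives:
  fixes \<Gamma> :: "((complex^'n^'n) \<times> (complex^'n)) set"
  assumes orbit: "\<And>x y. affine_orbit \<Gamma> x = affine_orbit \<Gamma> y \<longleftrightarrow> y \<in> affine_orbit \<Gamma> x"
    and compact: "compact_space (orbit_space \<Gamma>)"
  obtains R where "\<And>x. \<exists>g\<in>\<Gamma>. norm (affine_act g x) < R"
proof -
  let ?q = "affine_orbit \<Gamma>"
  have "istopology (\<lambda>U. U \<subseteq> range ?q \<and> open (?q -` U))"
    unfolding istopology_def by (auto simp: vimage_Union)
  then have openin: "openin (orbit_space \<Gamma>) U \<longleftrightarrow> U \<subseteq> range ?q \<and> open (?q -` U)" for U
    by (simp add: orbit_space_def topology_inverse')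
  have top: "topspace (orbit_space \<Gamma>) = range ?q"
  proof
    have "openin (orbit_space \<Gamma>) (range ?q)"
      using open_UNIV[where 'a = "complex^'n"] by (simp add: openin vimage_def)
    then show "range ?q \<subseteq> topspace (orbit_space \<Gamma>)" by (rule openin_subset)
    show "topspace (orbit_space \<Gamma>) \<subseteq> range ?q"
      using openin_topspace[of "orbit_space \<Gamma>"] unfolding openin by blast
  qed
  have "openin (orbit_space \<Gamma>) (?q ` ball 0 r)" for r
  proof -
    \<comment> \<open>The saturation of the ball is a union of preimages of the ball under the
      affine maps in \<Gamma>, hence open.\<close>
    have "?q -` (?q ` ball 0 r) = (\<Union>g\<in>\<Gamma>. affine_act g -` ball 0 r)"
    proof (intro subset_antisym subsetI)
      fix x assume "x \<in> ?q -` (?q ` ball 0 r)"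
      then obtain y where "y \<in> ball 0 r" "y \<in> ?q x" using orbit by blast
      then show "x \<in> (\<Union>g\<in>\<Gamma>. affine_act g -` ball 0 r)" by (auto simp: affine_orbit_def)
    next
      fix x assume "x \<in> (\<Union>g\<in>\<Gamma>. affine_act g -` ball 0 r)"
      then obtain g where g: "g \<in> \<Gamma>" "affine_act g x \<in> ball 0 r" by blast
      then have "?q x = ?q (affine_act g x)"
        unfolding orbit by (simp add: affine_orbit_def)
      then show "x \<in> ?q -` (?q ` ball 0 r)" using g(2) by blast
    qed
    moreover have "open (affine_act g -` ball 0 r)" for g :: "(complex^'n^'n) \<times> (complex^'n)"
      unfolding affine_act_def
      by (intro open_vimage) (auto intro!: continuous_intros matrix_vector_mult_linear_continuous_on)
    ultimately show ?thesis by (auto simp: openin)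
  qed
  then have balls_open: "openin (orbit_space \<Gamma>) U" if "U \<in> range (\<lambda>k::nat. ?q ` ball 0 (real k))" for U
    using that by blast
  have balls_cover: "topspace (orbit_space \<Gamma>) \<subseteq> \<Union> (range (\<lambda>k::nat. ?q ` ball 0 (real k)))"
  proof
    fix c assume "c \<in> topspace (orbit_space \<Gamma>)"
    then obtain x where "c = ?q x" unfolding top by blast
    moreover obtain k :: nat where "x \<in> ball 0 (real k)"
      using reals_Archimedean2[of "norm x"] by auto
    ultimately show "c \<in> \<Union> (range (\<lambda>k::nat. ?q ` ball 0 (real k)))" by blast
  qed
  have "\<exists>\<F>. finite \<F> \<and> \<F> \<subseteq> range (\<lambda>k::nat. ?q ` ball 0 (real k)) \<and> range ?q \<subseteq> \<Union> \<F>"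
    using compactinD[OF compact[unfolded compact_space_def] balls_open balls_cover] unfolding top .
  then obtain \<F> where \<F>: "finite \<F>" "\<F> \<subseteq> range (\<lambda>k::nat. ?q ` ball 0 (real k))"
    "range ?q \<subseteq> \<Union> \<F>"
    by (elim exE conjE)
  then obtain K where K: "finite K" "\<F> = (\<lambda>k::nat. ?q ` ball 0 (real k)) ` K"
    using finite_subset_image[OF \<F>(1,2)] by (elim exE conjE)
  \<comment> \<open>Inserting 0 gives the maximum a meaning even for empty \<open>K\<close>.\<close>
  define R where "R = real (Max (insert 0 K))"
  have "\<exists>g\<in>\<Gamma>. norm (affine_act g x) < R" for x
  proof -
    have "?q x \<in> \<Union> \<F>" using \<F>(3) by blast
    then obtain k y where k: "k \<in> K" "norm y < real k" "?q x = ?q y"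
      unfolding K(2) by auto
    moreover have "real k \<le> R" using k(1) K(1) unfolding R_def by simp
    moreover have "y \<in> ?q x" using k(3) orbit by blast
    moreover from this obtain g where "g \<in> \<Gamma>" "y = affine_act g x"
      by (auto simp: affine_orbit_def)
    ultimately show ?thesis by force
  qed
  then show thesis by (rule that)
qed

section \<open>Group-theoretic consequences of the CHW conditions\<close>

locale CHW =
  fixes \<Gamma> :: "((complex^'n^'n) \<times> (complex^'n)) set"
  assumes CHW: "CHW_group \<Gamma>"
begin

lemma subgroup_\<Gamma>: "subgroup \<Gamma> unitary_affine_group"
  using CHW by (simp add: CHW_group_def flat_Kaehler_group_def)

lemma one_mem: "(mat 1, 0) \<in> \<Gamma>"
  using subgroup.one_closed[OF subgroup_\<Gamma>] by (simp add: unitary_affine_group_def)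

lemma mult_mem: "g \<in> \<Gamma> \<Longrightarrow> h \<in> \<Gamma> \<Longrightarrow> (fst g ** fst h, fst g *v snd h + snd g) \<in> \<Gamma>"
  using subgroup.m_closed[OF subgroup_\<Gamma>, of g h] by (simp add: unitary_affine_group_def)

lemma inverse_mem:
  assumes "g \<in> \<Gamma>"
  obtains h where "h \<in> \<Gamma>" "fst h ** fst g = mat 1" "fst h *v snd g + snd h = 0"
proof -
  interpret group unitary_affine_group by (rule group_unitary_affine_group)
  have g: "g \<in> carrier unitary_affine_group"
    using subgroup.subset[OF subgroup_\<Gamma>] assms by blast
  show thesis
    using that[OF subgroup.m_inv_closed[OF subgroup_\<Gamma> assms]] l_inv[OF g]
    by (simp add: unitary_affine_group_def)
qed

text \<open>The exponent 2 case of torsion-freeness: the two equations say that the square of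
  \<open>g\<close> is the identity.\<close>

lemma torsion_free:
  assumes "g \<in> \<Gamma>" "fst g ** fst g = mat 1" "fst g *v snd g + snd g = 0"
  shows "g = (mat 1, 0)"
proof -
  interpret group unitary_affine_group by (rule group_unitary_affine_group)
  have g: "g \<in> carrier unitary_affine_group"
    using subgroup.subset[OF subgroup_\<Gamma>] assms by blast
  have "g [^]\<^bsub>unitary_affine_group\<^esub> (2::nat) = g \<otimes>\<^bsub>unitary_affine_group\<^esub> g"
    using g by (simp add: numeral_2_eq_2)
  also have "\<dots> = \<one>\<^bsub>unitary_affine_group\<^esub>"
    using assms by (simp add: unitary_affine_group_def)
  finally have "g = \<one>\<^bsub>unitary_affine_group\<^esub>"
    using CHW assms(1) zero_less_numeral unfolding CHW_group_def flat_Kaehler_group_def by blast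
  then show ?thesis by (simp add: unitary_affine_group_def)
qed

lemma affine_orbit_eq_iff: "affine_orbit \<Gamma> x = affine_orbit \<Gamma> y \<longleftrightarrow> y \<in> affine_orbit \<Gamma> x"
proof
  have mult: "affine_act g (affine_act h z) \<in> affine_orbit \<Gamma> z" if "g \<in> \<Gamma>" "h \<in> \<Gamma>" for g h z
  proof -
    have "affine_act g (affine_act h z) = affine_act (fst g ** fst h, fst g *v snd h + snd g) z"
      by (simp add: affine_act_def matrix_vector_right_distrib matrix_vector_mul_assoc)
    then show ?thesis using mult_mem[OF that] by (auto simp: affine_orbit_def)
  qed
  have refl: "z \<in> affine_orbit \<Gamma> z" for z
    using one_mem by (force simp: affine_orbit_def affine_act_def)
  then show "affine_orbit \<Gamma> x = affine_orbit \<Gamma> y \<Longrightarrow> y \<in> affine_orbit \<Gamma> x" by blast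
  assume "y \<in> affine_orbit \<Gamma> x"
  then obtain g where g: "g \<in> \<Gamma>" "y = affine_act g x" by (auto simp: affine_orbit_def)
  obtain h where h: "h \<in> \<Gamma>" "fst h ** fst g = mat 1" "fst h *v snd g + snd h = 0"
    using inverse_mem[OF g(1)] .
  have "affine_act h y = (fst h ** fst g) *v x + (fst h *v snd g + snd h)"
    by (simp add: g(2) affine_act_def matrix_vector_right_distrib matrix_vector_mul_assoc add.assoc)
  then have x: "x = affine_act h y" by (simp add: h)
  have "affine_orbit \<Gamma> y \<subseteq> affine_orbit \<Gamma> x"
    unfolding g(2) by (subst affine_orbit_def) (use mult[OF _ g(1)] in blast)
  moreover have "affine_orbit \<Gamma> x \<subseteq> affine_orbit \<Gamma> y"
    by (subst x, subst affine_orbit_def) (use mult[OF _ h(1)] in blast)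
  ultimately show "affine_orbit \<Gamma> x = affine_orbit \<Gamma> y" by blast
qed

lemma bounded_representatives: obtains R where "\<And>x. \<exists>g\<in>\<Gamma>. norm (affine_act g x) < R"
  using orbit_space_compact_imp_bounded_representatives[OF affine_orbit_eq_iff] CHW
  by (auto simp: CHW_group_def flat_Kaehler_group_def)

lemma holonomy_mult: "A \<in> holonomy \<Gamma> \<Longrightarrow> B \<in> holonomy \<Gamma> \<Longrightarrow> A ** B \<in> holonomy \<Gamma>"
  unfolding holonomy_def using mult_mem by force

lemma holonomy_one: "mat 1 \<in> holonomy \<Gamma>"
  unfolding holonomy_def using one_mem by force

text \<open>All three facts are carried back along the isomorphism with the elementary abelian
  2-group of rank n - 1.\<close>

lemma
  shows holonomy_square: "A \<in> holonomy \<Gamma> \<Longrightarrow> A ** A = mat 1"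
    and holonomy_commute: "A \<in> holonomy \<Gamma> \<Longrightarrow> B \<in> holonomy \<Gamma> \<Longrightarrow> A ** B = B ** A"
    and card_holonomy: "card (holonomy \<Gamma>) = 2 ^ (CARD('n) - 1)"
proof -
  let ?E = "product_group {..<CARD('n) - 1} (\<lambda>_. integer_mod_group 2)"
  obtain \<phi> where \<phi>: "\<phi> \<in> iso (holonomy_group \<Gamma>) ?E"
    using CHW by (auto simp: CHW_group_def is_iso_def)
  have bij: "bij_betw \<phi> (holonomy \<Gamma>) (carrier ?E)"
    using \<phi> by (simp add: iso_def holonomy_group_def)
  have hom: "\<phi> (A ** B) = \<phi> A \<otimes>\<^bsub>?E\<^esub> \<phi> B" if "A \<in> holonomy \<Gamma>" "B \<in> holonomy \<Gamma>" for A B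
    using \<phi> that by (auto simp: iso_def hom_def holonomy_group_def unitary_group_def)
  have mem: "\<phi> A \<in> carrier ?E" if "A \<in> holonomy \<Gamma>" for A
    using bij that by (auto simp: bij_betw_def)
  have inj: "A = B" if "A \<in> holonomy \<Gamma>" "B \<in> holonomy \<Gamma>" "\<phi> A = \<phi> B" for A B
    using bij that by (auto simp: bij_betw_def inj_on_def)
  have sq: "\<phi> (A ** A) = \<one>\<^bsub>?E\<^esub>" if "A \<in> holonomy \<Gamma>" for A
    by (simp only: hom[OF that that] product_integer_mod_group_2(1)[OF mem[OF that] mem[OF that]])
  show "A ** A = mat 1" if "A \<in> holonomy \<Gamma>" for A
  proof (rule inj)
    show "\<phi> (A ** A) = \<phi> (mat 1)"
      using sq[OF that] sq[OF holonomy_one] by simp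
  qed (simp_all add: holonomy_mult holonomy_one that)
  show "A ** B = B ** A" if A: "A \<in> holonomy \<Gamma>" and B: "B \<in> holonomy \<Gamma>" for A B
  proof (rule inj)
    show "\<phi> (A ** B) = \<phi> (B ** A)"
      by (simp only: hom[OF A B] hom[OF B A] product_integer_mod_group_2(2)[OF mem[OF A] mem[OF B]])
  qed (simp_all add: holonomy_mult A B)
  show "card (holonomy \<Gamma>) = 2 ^ (CARD('n) - 1)"
    using bij_betw_same_card[OF bij]
    by (simp add: card_PiE carrier_integer_mod_group)
qed

lemma finite_holonomy: "finite (holonomy \<Gamma>)"
  using card_holonomy by (metis card.infinite power_not_zero zero_neq_numeral)

lemma holonomy_det: "A \<in> holonomy \<Gamma> \<Longrightarrow> det A = 1"
  using CHW by (simp add: CHW_group_def)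

lemma translation_mem_iff: "v \<in> translation_lattice \<Gamma> \<longleftrightarrow> (mat 1, v) \<in> \<Gamma>"
  by (simp add: translation_lattice_def)

lemma translation_zero: "0 \<in> translation_lattice \<Gamma>"
  using one_mem by (simp add: translation_mem_iff)

lemma translation_add:
  "v \<in> translation_lattice \<Gamma> \<Longrightarrow> w \<in> translation_lattice \<Gamma> \<Longrightarrow> v + w \<in> translation_lattice \<Gamma>"
  using mult_mem[of "(mat 1, v)" "(mat 1, w)"] by (simp add: translation_mem_iff add.commute)

lemma translation_uminus:
  assumes "v \<in> translation_lattice \<Gamma>" shows "- v \<in> translation_lattice \<Gamma>"
proof -
  obtain h where h: "h \<in> \<Gamma>" "fst h = mat 1" "fst h *v v + snd h = 0"
    using inverse_mem[of "(mat 1, v)"] assms by (auto simp: translation_mem_iff)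
  then have "h = (mat 1, - v)" by (simp add: prod_eq_iff add_eq_0_iff)
  then show ?thesis using h by (simp add: translation_mem_iff)
qed

lemma translation_diff:
  "v \<in> translation_lattice \<Gamma> \<Longrightarrow> w \<in> translation_lattice \<Gamma> \<Longrightarrow> v - w \<in> translation_lattice \<Gamma>"
  using translation_add[OF _ translation_uminus, of v w] by simp

lemma translation_sum:
  "(\<And>i. i \<in> I \<Longrightarrow> v i \<in> translation_lattice \<Gamma>) \<Longrightarrow> (\<Sum>i\<in>I. v i) \<in> translation_lattice \<Gamma>"
  by (induction I rule: infinite_finite_induct) (auto simp: translation_zero translation_add)

lemma translation_of_int_scale:
  "v \<in> translation_lattice \<Gamma> \<Longrightarrow> of_int k *s v \<in> translation_lattice \<Gamma>"
proof (induction k rule: int_induct[where k = 0])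
  case (step1 i)
  then show ?case using translation_add[of "of_int i *s v" v] by (simp add: vector_sadd_rdistrib)
next
  case (step2 i)
  then show ?case using translation_diff[of "of_int i *s v" v] by (simp add: vector_sub_rdistrib)
qed (simp add: translation_zero)

lemma translation_act:
  assumes "A \<in> holonomy \<Gamma>" "v \<in> translation_lattice \<Gamma>"
  shows "A *v v \<in> translation_lattice \<Gamma>"
proof -
  interpret group unitary_affine_group by (rule group_unitary_affine_group)
  obtain g where g: "g \<in> \<Gamma>" "A = fst g" using assms(1) by (auto simp: holonomy_def)
  then have "g \<in> carrier unitary_affine_group"
    using subgroup.subset[OF subgroup_\<Gamma>] by blast
  from translation_conj[OF this, of v] show ?thesis
    using subgroup.m_closed[OF subgroup_\<Gamma>] subgroup.m_inv_closed[OF subgroup_\<Gamma>] g assms(2)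
    by (metis translation_mem_iff)
qed

lemma translation_discrete:
  obtains e where "e > 0" "\<And>v. v \<in> translation_lattice \<Gamma> \<Longrightarrow> norm v < e \<Longrightarrow> v = 0"
proof -
  have "(mat 1, 0) isolated_in \<Gamma>"
    using CHW one_mem by (auto simp: CHW_group_def flat_Kaehler_group_def discrete_def)
  then obtain e where e: "e > 0" "\<And>g. g \<in> \<Gamma> \<Longrightarrow> dist (mat 1, 0) g < e \<Longrightarrow> g = (mat 1, 0)"
    unfolding isolated_in_dist_Ex_iff by blast
  show thesis
  proof (rule that[OF e(1)])
    fix v assume "v \<in> translation_lattice \<Gamma>" "norm v < e"
    then show "v = 0" using e(2)[of "(mat 1, v)"] by (simp add: translation_mem_iff dist_Pair_Pair)
  qed
qed

end

section \<open>Existence of the diagonal representation\<close>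

lemma card_diagonal_sign_matrices_le:
  "finite (diagonal_sign_matrices :: (int^'n^'n) set)"
  "card (diagonal_sign_matrices :: (int^'n^'n) set) \<le> 2 ^ (CARD('n) - 1)"
proof -
  fix i\<^sub>0 :: 'n
  let ?D = "diagonal_sign_matrices :: (int^'n^'n) set" and ?I = "UNIV - {i\<^sub>0}"
  let ?r = "\<lambda>D::int^'n^'n. restrict (\<lambda>i. D $ i $ i) ?I"
  \<comment> \<open>Determinant 1 recovers the omitted entry at \<open>i\<^sub>0\<close> from the
    other n - 1 signs.\<close>
  have "inj_on ?r ?D"
  proof (rule inj_onI)
    fix D E assume D: "D \<in> ?D" and E: "E \<in> ?D" and DE: "?r D = ?r E"
    have eq: "D $ i $ i = E $ i $ i" if "i \<noteq> i\<^sub>0" for i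
      using fun_cong[OF DE, of i] that by simp
    have prod: "C $ i\<^sub>0 $ i\<^sub>0 * (\<Prod>i\<in>?I. C $ i $ i) = 1" if "C \<in> ?D" for C
    proof -
      have "det C = (\<Prod>i\<in>UNIV. C $ i $ i)"
        using that by (intro det_diagonal) (simp add: diagonal_sign_matrices_def)
      also have "\<dots> = C $ i\<^sub>0 $ i\<^sub>0 * (\<Prod>i\<in>?I. C $ i $ i)"
        by (rule prod.remove) auto
      finally have "det C = C $ i\<^sub>0 $ i\<^sub>0 * (\<Prod>i\<in>?I. C $ i $ i)" .
      moreover have "det C = 1" using that by (simp only: diagonal_sign_matrices_def mem_Collect_eq)
      ultimately show ?thesis by (rule trans[OF sym])
    qed
    define p where "p = (\<Prod>i\<in>?I. E $ i $ i)"
    have "(\<Prod>i\<in>?I. D $ i $ i) = p"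
      unfolding p_def using eq by (intro prod.cong) auto
    then have "D $ i\<^sub>0 $ i\<^sub>0 * p = 1" "E $ i\<^sub>0 $ i\<^sub>0 * p = 1"
      using prod[OF D] prod[OF E] by (simp_all only: p_def)
    then have "D $ i\<^sub>0 $ i\<^sub>0 = E $ i\<^sub>0 $ i\<^sub>0"
      by (metis mult_cancel_right mult_zero_right zero_neq_one)
    then have "D $ i $ j = E $ i $ j" for i j
      using D E eq[of i] by (cases "i = j"; cases "i = i\<^sub>0") (auto simp: diagonal_sign_matrices_def)
    then show "D = E" by (simp add: vec_eq_iff)
  qed
  moreover have "?r ` ?D \<subseteq> PiE ?I (\<lambda>_. {1, -1})"
    by (auto simp: diagonal_sign_matrices_def split: if_splits)
  moreover have "finite (PiE ?I (\<lambda>_. {1, -1 :: int}))" by (intro finite_PiE) auto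
  ultimately have "finite ?D \<and> card ?D \<le> card (PiE ?I (\<lambda>_. {1, -1 :: int}))"
    by (meson card_inj_on_le inj_on_finite)
  then show "finite ?D" "card ?D \<le> 2 ^ (CARD('n) - 1)"
    by (simp_all add: card_PiE card_Diff_singleton numeral_2_eq_2)
qed

context CHW begin

text \<open>Common eigenvectors give \<open>P\<close> and their eigenvalues give \<rho>.
  Surjectivity onto the sign matrices is a count: \<rho> is injective on 2^(n-1) elements and the
  target has no more than that.\<close>

lemma diagonal_rep_exists: "\<exists>\<rho>. diagonal_rep \<Gamma> \<rho>"
proof -
  obtain P :: "complex^'n^'n" where P: "invertible P"
    "\<And>A i. A \<in> holonomy \<Gamma> \<Longrightarrow> A *v column i P = column i P \<or> A *v column i P = - column i P"
    using simultaneous_diagonalization[OF finite_holonomy holonomy_square holonomy_commute] by metis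
  define s where "s A i = (if A *v column i P = column i P then 1 else -1 :: int)" for A i
  define \<rho> where "\<rho> A = (\<chi> i j. if i = j then s A i else 0)" for A
  have s: "A *v column i P = of_int (s A i) *s column i P" if "A \<in> holonomy \<Gamma>" for A i
    using P(2)[OF that, of i] by (auto simp: s_def vec_eq_iff)
  have AP: "A ** P = P ** map_matrix of_int (\<rho> A)" if "A \<in> holonomy \<Gamma>" for A
  proof -
    have "(A ** P) $ r $ c = (P ** map_matrix of_int (\<rho> A)) $ r $ c" for r c
    proof -
      have "(A ** P) $ r $ c = (A *v column c P) $ r"
        by (simp add: matrix_matrix_mult_def matrix_vector_mult_def column_def)
      also have "\<dots> = of_int (s A c) * P $ r $ c"
        unfolding s[OF that] by (simp add: column_def)
      also have "\<dots> = (\<Sum>k\<in>UNIV. if k = c then P $ r $ k * of_int (s A k) else 0)"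
        by simp
      also have "\<dots> = (P ** map_matrix of_int (\<rho> A)) $ r $ c"
        by (simp add: matrix_matrix_mult_def \<rho>_def if_distrib cong: if_cong)
      finally show ?thesis .
    qed
    then show ?thesis by (simp add: vec_eq_iff)
  qed
  have det\<rho>: "det (\<rho> A) = 1" if "A \<in> holonomy \<Gamma>" for A
  proof -
    have "det P * det (map_matrix of_int (\<rho> A) :: complex^'n^'n) = det P"
      using arg_cong[OF AP[OF that], of det] holonomy_det[OF that] by (simp add: det_mul)
    then have "det (map_matrix of_int (\<rho> A) :: complex^'n^'n) = 1"
      using P(1) by (simp add: invertible_det_nz)
    moreover have "det (map_matrix of_int (\<rho> A) :: complex^'n^'n) = of_int (det (\<rho> A))"
      by (simp add: det_diagonal \<rho>_def)
    ultimately show ?thesis by (metis of_int_eq_1_iff)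
  qed
  have "\<rho> ` holonomy \<Gamma> = diagonal_sign_matrices"
  proof (rule card_seteq[OF card_diagonal_sign_matrices_le(1)])
    show "\<rho> ` holonomy \<Gamma> \<subseteq> diagonal_sign_matrices"
      using det\<rho> by (auto simp: diagonal_sign_matrices_def \<rho>_def s_def split: if_splits)
    have "inj_on \<rho> (holonomy \<Gamma>)"
    proof (rule inj_onI)
      fix A B assume "A \<in> holonomy \<Gamma>" "B \<in> holonomy \<Gamma>" "\<rho> A = \<rho> B"
      then have "A ** P = B ** P" using AP by metis
      then show "A = B"
        using P(1) by (metis invertible_def matrix_mul_assoc matrix_mul_rid)
    qed
    then show "card (diagonal_sign_matrices :: (int^'n^'n) set) \<le> card (\<rho> ` holonomy \<Gamma>)"
      using card_diagonal_sign_matrices_le(2)[where 'n = 'n] by (simp add: card_image card_holonomy)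
  qed
  then show ?thesis
    unfolding diagonal_rep_def using P(1) AP by blast
qed

end

section \<open>Coordinates along the eigenlines of the holonomy\<close>

locale CHW_diagonal = CHW \<Gamma> for \<Gamma> :: "((complex^'n^'n) \<times> (complex^'n)) set" +
  fixes \<rho> :: "complex^'n^'n \<Rightarrow> int^'n^'n" and P :: "complex^'n^'n"
  assumes P_invertible: "invertible P"
    and intertwine: "A \<in> holonomy \<Gamma> \<Longrightarrow> A ** P = P ** map_matrix of_int (\<rho> A)"
    and \<rho>_image: "\<rho> ` holonomy \<Gamma> = diagonal_sign_matrices"
begin

abbreviation "\<Lambda> \<equiv> translation_lattice \<Gamma>"

definition coord :: "complex^'n \<Rightarrow> complex^'n" where
  "coord x = matrix_inv P *v x"

lemma matrix_inv_P: "matrix_inv P ** P = mat 1" "P ** matrix_inv P = mat 1"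
  using someI_ex[OF P_invertible[unfolded invertible_def]] by (simp_all add: matrix_inv_def)

lemma coord_P: "coord (P *v y) = y"
  using matrix_inv_P(1) by (simp add: coord_def matrix_vector_mul_assoc)

lemma P_coord: "P *v coord x = x"
  using matrix_inv_P(2) by (simp add: coord_def matrix_vector_mul_assoc)

lemma coord_add: "coord (x + y) = coord x + coord y"
  by (simp add: coord_def matrix_vector_right_distrib)

lemma coord_diff: "coord (x - y) = coord x - coord y"
  by (simp add: coord_def matrix_vector_mult_diff_distrib)

lemma coord_scaleR: "coord (r *\<^sub>R x) = r *\<^sub>R coord x"
  unfolding coord_def
  by (rule linear_scale[OF bounded_linear.linear[OF matrix_vector_mul_bounded_linear]])

lemma \<rho>_diagonal: "A \<in> holonomy \<Gamma> \<Longrightarrow> i \<noteq> j \<Longrightarrow> \<rho> A $ i $ j = 0"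
  using \<rho>_image by (auto simp: diagonal_sign_matrices_def)

lemma \<rho>_sign: "A \<in> holonomy \<Gamma> \<Longrightarrow> \<rho> A $ i $ i \<in> {1, -1}"
  using \<rho>_image by (auto simp: diagonal_sign_matrices_def)

lemma \<rho>_mult_vec:
  assumes "A \<in> holonomy \<Gamma>" shows "(\<rho> A *v y) $ i = \<rho> A $ i $ i * y $ i"
proof -
  have "(\<rho> A *v y) $ i = (\<Sum>j\<in>UNIV. if j = i then \<rho> A $ i $ i * y $ i else 0)"
    unfolding matrix_vector_mult_def vec_lambda_beta
    using \<rho>_diagonal[OF assms] by (intro sum.cong) auto
  then show ?thesis by simp
qed

lemma coord_act:
  assumes "A \<in> holonomy \<Gamma>" shows "coord (A *v x) $ i = of_int (\<rho> A $ i $ i) * coord x $ i"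
proof -
  have "A *v x = P *v (map_matrix of_int (\<rho> A) *v coord x)"
    by (metis P_coord assms intertwine matrix_vector_mul_assoc)
  then have "coord (A *v x) $ i = (\<Sum>j\<in>UNIV. of_int (\<rho> A $ i $ j) * coord x $ j)"
    by (simp add: coord_P) (simp add: matrix_vector_mult_def)
  also have "\<dots> = (\<Sum>j\<in>UNIV. if j = i then of_int (\<rho> A $ i $ i) * coord x $ i else 0)"
    using \<rho>_diagonal[OF assms] by (intro sum.cong) auto
  finally show ?thesis by simp
qed

lemma coord_eqI: "(\<And>i. coord x $ i = coord y $ i) \<Longrightarrow> x = y"
  by (metis P_coord vec_eq_iff)

text \<open>In even dimension -1 has determinant 1 and so is a holonomy element; but any motion with
  linear part -1 squares to the identity, contradicting torsion-freeness.\<close>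

lemma odd_dimension: "odd CARD('n)"
proof
  assume "even CARD('n)"
  then have "(\<chi> i j. if i = j then -1 else 0) \<in> (diagonal_sign_matrices :: (int^'n^'n) set)"
    by (simp add: diagonal_sign_matrices_def det_diagonal)
  then obtain A where A: "A \<in> holonomy \<Gamma>" "\<rho> A = (\<chi> i j. if i = j then -1 else 0)"
    using \<rho>_image by (metis (no_types, lifting) imageE)
  obtain g where g: "g \<in> \<Gamma>" "A = fst g" using A by (auto simp: holonomy_def)
  have neg: "A *v x = - x" for x
  proof (rule coord_eqI)
    show "coord (A *v x) $ i = coord (- x) $ i" for i
      using coord_diff[of 0 x] coord_diff[of 0 0] by (simp add: coord_act A)
  qed
  have "g = (mat 1, 0)"
    using g neg holonomy_square[OF A(1)] by (intro torsion_free) auto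
  then have "x = - x" for x :: "complex^'n" using neg[of x] g by simp
  from this[of "vec 1"] show False by (simp add: vec_eq_iff)
qed

text \<open>The sign matrix with 1 at place \<open>i\<close> and -1 elsewhere has determinant
  (-1)^(n-1), which is 1 because n is odd.\<close>

lemma flip_exists:
  obtains A where "A \<in> holonomy \<Gamma>"
    "\<And>x j. coord (A *v x) $ j = (if j = i then coord x $ j else - coord x $ j)"
proof -
  let ?D = "\<chi> j k. if j = k then if j = i then 1 else -1 else (0::int)"
  have "(\<Prod>j\<in>UNIV. if j = i then 1 else -1 :: int) = (\<Prod>j\<in>UNIV - {i}. -1)"
    by (subst prod.remove[of _ i]) (auto intro: prod.cong)
  also have "\<dots> = 1" using odd_dimension by (simp add: card_Diff_singleton)
  finally have "?D \<in> diagonal_sign_matrices"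
    by (simp add: diagonal_sign_matrices_def det_diagonal)
  then obtain A where "A \<in> holonomy \<Gamma>" "\<rho> A = ?D"
    using \<rho>_image by (metis (no_types, lifting) imageE)
  then show thesis using coord_act by (intro that[of A]) auto
qed

section \<open>Lattice vectors on an eigenline and projections to it\<close>

definition line_lattice :: "'n \<Rightarrow> complex set" where
  "line_lattice i = {z. P *v axis i z \<in> \<Lambda>}"

text \<open>The factor 2 puts the projection of the lattice inside \<open>line_lattice i\<close>, so
  that the two can be compared as subgroups of one plane lattice.\<close>

definition doubled_projection :: "'n \<Rightarrow> complex set" where
  "doubled_projection i = (\<lambda>v. 2 * coord v $ i) ` \<Lambda>"

lemma P_axis_add: "P *v axis i (y + z) = P *v axis i y + P *v axis i z"
  by (simp add: axis_def vec_eq_iff matrix_vector_mult_def flip: sum.distrib)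
     (auto intro!: sum.cong simp: algebra_simps)

lemma P_axis_diff: "P *v axis i (y - z) = P *v axis i y - P *v axis i z"
  using P_axis_add[of i "y - z" z] by simp

lemma P_axis_scale: "P *v axis i (c * z) = c *s (P *v axis i z)"
  by (simp add: axis_def vec_eq_iff matrix_vector_mult_def sum_distrib_left)
     (auto intro!: sum.cong)

lemma P_axis_zero: "P *v axis i 0 = 0"
  using P_axis_diff[of i 0 0] by simp

lemma coord_P_axis: "coord (P *v axis i z) $ j = (if j = i then z else 0)"
  by (simp add: coord_P axis_def)

text \<open>The flip is twice the projection to the eigenline minus the identity. Applied to a
  lattice vector this yields a vector of the line lattice; applied to the translation part of a
  motion over the flip it yields the square of that motion.\<close>

lemma flip_plus:
  assumes "\<And>x j. coord (A *v x) $ j = (if j = i then coord x $ j else - coord x $ j)"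
  shows "A *v x + x = P *v axis i (2 * coord x $ i)"
  by (rule coord_eqI) (simp add: coord_add coord_P_axis assms)

lemma line_lattice_diff: "x \<in> line_lattice i \<Longrightarrow> y \<in> line_lattice i \<Longrightarrow> x - y \<in> line_lattice i"
  by (simp add: line_lattice_def P_axis_diff translation_diff)

lemma doubled_projection_diff:
  "x \<in> doubled_projection i \<Longrightarrow> y \<in> doubled_projection i \<Longrightarrow> x - y \<in> doubled_projection i"
  unfolding doubled_projection_def using translation_diff
  by (force simp: coord_diff right_diff_distrib)

lemma double_line_lattice: "x \<in> line_lattice i \<Longrightarrow> 2 * x \<in> doubled_projection i"
  unfolding doubled_projection_def line_lattice_def
  using coord_P_axis[of i x i] by (metis (mono_tags, lifting) image_eqI mem_Collect_eq)

lemma doubled_projection_subset: "doubled_projection i \<subseteq> line_lattice i"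
proof
  fix z assume "z \<in> doubled_projection i"
  then obtain v where v: "v \<in> \<Lambda>" "z = 2 * coord v $ i"
    by (auto simp: doubled_projection_def)
  obtain A where A: "A \<in> holonomy \<Gamma>"
    "\<And>x j. coord (A *v x) $ j = (if j = i then coord x $ j else - coord x $ j)"
    by (rule flip_exists[of i]) blast
  have "A *v v + v \<in> \<Lambda>" using A(1) v(1) by (intro translation_add translation_act)
  then show "z \<in> line_lattice i"
    unfolding flip_plus[OF A(2)] v(2) by (simp add: line_lattice_def)
qed

lemma line_lattice_discrete:
  obtains e where "e > 0" "\<And>z. z \<in> line_lattice i \<Longrightarrow> norm z < e \<Longrightarrow> z = 0"
proof -
  obtain e where e: "e > 0" "\<And>v. v \<in> \<Lambda> \<Longrightarrow> norm v < e \<Longrightarrow> v = 0"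
    using translation_discrete by blast
  have "linear (\<lambda>z. P *v axis i z)"
    by (rule linearI)
       (simp_all add: P_axis_add scaleR_conv_of_real[where 'a = complex] P_axis_scale vec_eq_iff)
  then obtain K where K: "K > 0" "\<And>z. norm (P *v axis i z) \<le> norm z * K"
    using bounded_linear.pos_bounded linear_conv_bounded_linear by blast
  show thesis
  proof (rule that[of "e / K"])
    fix z assume z: "z \<in> line_lattice i" "norm z < e / K"
    then have "norm (P *v axis i z) < e"
      using K(1) K(2)[of z] by (simp add: field_simps)
    then have "P *v axis i z = 0" using z e(2) by (simp add: line_lattice_def)
    then show "z = 0" using coord_P_axis[of i z i] coord_diff[of 0 0] by simp
  qed (use e(1) K(1) in simp)
qed

text \<open>With \<open>k\<close> the inverse of \<open>h\<close>, the product \<open>k g\<close> is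
  the translation by \<open>fst k\<close> applied to the difference; acting by \<open>fst h\<close>
  brings the difference itself into the lattice.\<close>

lemma translation_part_unique:
  assumes "g \<in> \<Gamma>" "h \<in> \<Gamma>" "fst g = fst h"
  shows "snd g - snd h \<in> \<Lambda>"
proof -
  obtain k where k: "k \<in> \<Gamma>" "fst k ** fst h = mat 1" "fst k *v snd h + snd k = 0"
    using inverse_mem[OF assms(2)] by blast
  have "(mat 1, fst k *v snd g + snd k) \<in> \<Gamma>"
    using mult_mem[OF k(1) assms(1)] assms(3) k(2) by simp
  also have "fst k *v snd g + snd k = fst k *v (snd g - snd h)"
    using k(3) by (simp add: matrix_vector_mult_diff_distrib algebra_simps add_eq_0_iff)
  finally have "fst h *v (fst k *v (snd g - snd h)) \<in> \<Lambda>"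
    using assms(2) by - (rule translation_act, auto simp: holonomy_def translation_mem_iff[symmetric])
  moreover have "fst h ** fst k = mat 1" using k(2) by (simp add: matrix_left_right_inverse)
  ultimately show ?thesis by (simp add: matrix_vector_mul_assoc)
qed

text \<open>Otherwise some nonzero real functional on the eigenline would vanish on the projection of the
  lattice; by finiteness of the holonomy its absolute value would vary by a bounded amount along each
  orbit, contradicting cocompactness.\<close>

lemma line_lattice_spans:
  "\<exists>y\<in>line_lattice i. \<exists>z\<in>line_lattice i. Im (y * cnj z) \<noteq> 0"
proof (rule ccontr)
  assume degenerate: "\<not> ?thesis"
  \<comment> \<open>A real line through \<open>w\<close> contains the whole line lattice; if that
    lattice is trivial, any nonzero \<open>w\<close> will do.\<close>
  obtain w where w: "w \<noteq> 0" "\<And>z. z \<in> line_lattice i \<Longrightarrow> Im (z * cnj w) = 0"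
  proof (cases "line_lattice i \<subseteq> {0}")
    case True
    show thesis by (rule that[of 1]) (use True in auto)
  next
    case False
    then show thesis using degenerate that by blast
  qed
  \<comment> \<open>This real functional vanishes where the i-th coordinate is a real multiple of
    \<open>w\<close>; on lattice vectors that follows because their doubled coordinates lie in the
    line lattice.\<close>
  define l where "l x = Im (coord x $ i * cnj w)" for x
  have l_add: "l (x + y) = l x + l y" for x y
    by (simp add: l_def coord_add algebra_simps)
  have l_lattice: "l v = 0" if "v \<in> \<Lambda>" for v
  proof -
    have "2 * coord v $ i \<in> line_lattice i"
      using doubled_projection_subset that by (auto simp: doubled_projection_def)
    from w(2)[OF this] show ?thesis by (simp add: l_def algebra_simps)
  qed
  have l_act: "l (A *v x) = of_int (\<rho> A $ i $ i) * l x" if "A \<in> holonomy \<Gamma>" for A x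
    by (simp add: l_def coord_act[OF that] algebra_simps)
  have "linear l"
  proof (rule linearI)
    show "l (r *\<^sub>R x) = r *\<^sub>R l x" for r x
      by (simp add: l_def coord_scaleR algebra_simps)
  qed (rule l_add)
  then obtain K where K: "K > 0" "\<And>x. \<bar>l x\<bar> \<le> norm x * K"
    using bounded_linear.pos_bounded[of l] by (auto simp: linear_conv_bounded_linear)
  obtain R where R: "\<And>x. \<exists>g\<in>\<Gamma>. norm (affine_act g x) < R"
    using bounded_representatives by blast
  have "\<forall>A\<in>holonomy \<Gamma>. \<exists>g\<in>\<Gamma>. fst g = A" by (auto simp: holonomy_def)
  then obtain s where s: "\<And>A. A \<in> holonomy \<Gamma> \<Longrightarrow> s A \<in> \<Gamma>" "\<And>A. A \<in> holonomy \<Gamma> \<Longrightarrow> fst (s A) = A"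
    by metis
  \<comment> \<open>Motions with equal linear part have translation parts differing by a lattice
    vector, where \<open>l\<close> vanishes. One representative for each of the finitely many
    holonomy elements thus bounds \<open>l\<close> on all translation parts.\<close>
  define C where "C = (\<Sum>A\<in>holonomy \<Gamma>. \<bar>l (snd (s A))\<bar>)"
  have C: "\<bar>l (snd g)\<bar> \<le> C" if "g \<in> \<Gamma>" for g
  proof -
    have A: "fst g \<in> holonomy \<Gamma>" using that by (auto simp: holonomy_def)
    have "l (snd g - snd (s (fst g))) = 0"
      using s[OF A] that by (intro l_lattice translation_part_unique) auto
    then have "l (snd g) = l (snd (s (fst g)))"
      using l_add[of "snd g - snd (s (fst g))" "snd (s (fst g))"] by simp
    also have "\<bar>\<dots>\<bar> \<le> C"
      unfolding C_def using A finite_holonomy by (intro member_le_sum) auto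
    finally show ?thesis .
  qed
  \<comment> \<open>The direction \<open>\<i> * w\<close> is perpendicular to \<open>w\<close>, and
    \<open>t\<close> is scaled so that \<open>l x\<close> exceeds by 1 the bound
    \<open>R * K + C\<close> valid if some orbit point has norm below \<open>R\<close>.\<close>
  define t where "t = (R * K + C + 1) / (norm w)\<^sup>2"
  define x where "x = P *v axis i (of_real t * \<i> * w)"
  have lx: "l x = R * K + C + 1"
  proof -
    have "l x = t * (norm w)\<^sup>2"
      unfolding l_def x_def coord_P_axis cmod_power2
      by (simp add: power2_eq_square algebra_simps)
    then show ?thesis using w(1) by (simp add: t_def)
  qed
  obtain g where g: "g \<in> \<Gamma>" "norm (affine_act g x) < R" using R by blast
  have A: "fst g \<in> holonomy \<Gamma>" using g by (auto simp: holonomy_def)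
  have "\<bar>l x\<bar> = \<bar>l (fst g *v x)\<bar>"
    using \<rho>_sign[OF A, of i] by (auto simp: l_act[OF A])
  also have "\<dots> = \<bar>l (affine_act g x) - l (snd g)\<bar>"
    by (simp add: affine_act_def l_add)
  also have "\<dots> \<le> \<bar>l (affine_act g x)\<bar> + \<bar>l (snd g)\<bar>" by simp
  also have "\<dots> \<le> R * K + C"
    using K(2)[of "affine_act g x"] C[OF g(1)]
      mult_right_mono[OF less_imp_le[OF g(2)] less_imp_le[OF K(1)]]
    by linarith
  finally show False using lx by simp
qed

text \<open>Were the two equal, the square of a motion over the flip could be cancelled by a lattice
  translation, producing an element that squares to the identity. It must be trivial, which leaves
  only dimension one, where discreteness is violated instead.\<close>

lemma doubled_projection_proper: "doubled_projection i \<subset> line_lattice i"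
proof
  show "doubled_projection i \<subseteq> line_lattice i" by (rule doubled_projection_subset)
  show "doubled_projection i \<noteq> line_lattice i"
  proof
    assume eq: "doubled_projection i = line_lattice i"
    obtain A where A: "A \<in> holonomy \<Gamma>"
      "\<And>x j. coord (A *v x) $ j = (if j = i then coord x $ j else - coord x $ j)"
      by (rule flip_exists[of i]) blast
    obtain g where g: "g \<in> \<Gamma>" "A = fst g" using A(1) by (auto simp: holonomy_def)
    have "(mat 1, A *v snd g + snd g) \<in> \<Gamma>"
      using mult_mem[OF g(1) g(1)] holonomy_square[OF A(1)] g(2) by simp
    then have "2 * coord (snd g) $ i \<in> line_lattice i"
      unfolding flip_plus[OF A(2)] by (simp add: line_lattice_def translation_mem_iff)
    then obtain v where v: "v \<in> \<Lambda>" "2 * coord (snd g) $ i = 2 * coord v $ i"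
      unfolding eq[symmetric] by (auto simp: doubled_projection_def)
    \<comment> \<open>Composing with the translation by \<open>-v\<close> keeps the linear part and
      makes the i-th coordinate of the translation part zero, so by \<open>flip_plus\<close> the
      square is trivial.\<close>
    have "(A, snd g - v) \<in> \<Gamma>"
      using mult_mem[of "(mat 1, - v)" g] g v(1) translation_uminus[of v]
      by (simp add: translation_mem_iff)
    moreover have "A *v (snd g - v) + (snd g - v) = 0"
      unfolding flip_plus[OF A(2)] using v(2) by (simp add: coord_diff P_axis_zero)
    ultimately have "(A, snd g - v) = (mat 1, 0)"
      using torsion_free[of "(A, snd g - v)"] holonomy_square[OF A(1)] by simp
    \<comment> \<open>Now the flip is the identity, so \<open>i\<close> is the only axis and every
      vector equals its projection. Equality with the doubled projection makes the line lattice
      divisible by 2, and repeated halving contradicts discreteness.\<close>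
    then have "coord x $ j = 0" if "j \<noteq> i" for x j
      using A(2)[of x j] that by simp
    then have axis: "P *v axis i (coord v $ i) = v" for v
      by (intro coord_eqI) (auto simp: coord_P_axis)
    have half: "z / 2 \<in> line_lattice i" if "z \<in> line_lattice i" for z
    proof -
      obtain v where "v \<in> \<Lambda>" "z = 2 * coord v $ i"
        using \<open>z \<in> line_lattice i\<close> unfolding eq[symmetric] by (auto simp: doubled_projection_def)
      then show ?thesis by (simp add: line_lattice_def axis)
    qed
    obtain e where e: "e > 0" "\<And>z. z \<in> line_lattice i \<Longrightarrow> norm z < e \<Longrightarrow> z = 0"
      by (rule line_lattice_discrete[of i]) blast
    obtain z where z: "z \<in> line_lattice i" "z \<noteq> 0"
      using line_lattice_spans[of i] by (metis mult_zero_left zero_complex.sel(2))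
    have halves: "z / 2 ^ k \<in> line_lattice i" for k
    proof (induction k)
      case (Suc k)
      then show ?case using half[OF Suc] by (simp add: field_simps)
    qed (simp add: z)
    obtain k where "(1/2) ^ k < e / norm z"
      using real_arch_pow_inv[of "e / norm z" "1/2"] e(1) z(2) by auto
    then have "norm (z / 2 ^ k) < e"
      using z(2) by (simp add: norm_divide norm_power field_simps)
    then show False using e(2)[OF halves] z(2) by simp
  qed
qed

text \<open>In these coordinates the two summands of \<open>\<Lambda>\<close> are cut out by \<open>a = 0\<close> and \<open>b = 0\<close>.\<close>

lemma adapted_real_coordinates:
  obtains a b :: "complex^'n \<Rightarrow> real^'n"
  where "\<And>x y. a (x + y) = a x + a y" "\<And>x y. b (x + y) = b x + b y"
    and "\<And>A x i. A \<in> holonomy \<Gamma> \<Longrightarrow> a (A *v x) $ i = of_int (\<rho> A $ i $ i) * a x $ i"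
    and "\<And>A x i. A \<in> holonomy \<Gamma> \<Longrightarrow> b (A *v x) $ i = of_int (\<rho> A $ i $ i) * b x $ i"
    and "bij (\<lambda>x. (a x, b x))"
    and "\<And>x i. x \<in> \<Lambda> \<Longrightarrow> 2 * a x $ i \<in> \<int> \<and> b x $ i \<in> \<int>"
    and "\<And>x. (\<And>i. a x $ i \<in> \<int> \<and> b x $ i \<in> \<int>) \<Longrightarrow> x \<in> \<Lambda>"
proof -
  have "\<exists>u v. u \<in> line_lattice i \<and> v \<in> line_lattice i \<and> Im (u * cnj v) \<noteq> 0 \<and>
      (\<forall>z\<in>doubled_projection i. \<exists>a b :: int. z = of_int a * u + 2 * of_int b * v)" for i
  proof -
    obtain e where e: "e > 0" "\<And>z. z \<in> line_lattice i \<Longrightarrow> norm z < e \<Longrightarrow> z = 0"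
      by (rule line_lattice_discrete[of i]) blast
    obtain w\<^sub>1 w\<^sub>2 where w: "w\<^sub>1 \<in> line_lattice i" "w\<^sub>2 \<in> line_lattice i" "Im (w\<^sub>1 * cnj w\<^sub>2) \<noteq> 0"
      using line_lattice_spans[of i] by blast
    show ?thesis
      by (rule planar_lattice_adapted_basis[OF line_lattice_diff e doubled_projection_diff
            double_line_lattice doubled_projection_proper w]) blast+
  qed
  then obtain u v where u: "\<And>i. u i \<in> line_lattice i" and v: "\<And>i. v i \<in> line_lattice i"
    and uv: "\<And>i. Im (u i * cnj (v i)) \<noteq> 0"
    and basis: "\<And>i z. z \<in> doubled_projection i \<Longrightarrow> \<exists>a b :: int. z = of_int a * u i + 2 * of_int b * v i"
    by metis
  \<comment> \<open>Again Cramer's rule: \<alpha> and \<beta> read off the real coordinates with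
    respect to the basis \<open>u i\<close>, \<open>v i\<close> of each eigenline.\<close>
  define d where "d i = Im (u i * cnj (v i))" for i
  define \<alpha> where "\<alpha> i z = Im (z * cnj (v i)) / d i" for i z
  define \<beta> where "\<beta> i z = Im (u i * cnj z) / d i" for i z
  have d: "d i \<noteq> 0" for i using uv by (simp add: d_def)
  have expand: "of_real (\<alpha> i z) * u i + of_real (\<beta> i z) * v i = z" for i z
  proof -
    have "of_real (Im (z * cnj (v i))) * u i + of_real (Im (u i * cnj z)) * v i = of_real (d i) * z"
      by (simp add: complex_eq_iff d_def algebra_simps)
    then show ?thesis using d[of i] unfolding \<alpha>_def \<beta>_def
      by (simp del: times_complex.sel cnj.sel add: field_simps)
  qed
  have \<alpha>: "\<alpha> i (of_real r * u i + of_real s * v i) = r" for i r s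
    using d[of i] by (simp add: \<alpha>_def d_def field_simps)
  have \<beta>: "\<beta> i (of_real r * u i + of_real s * v i) = s" for i r s
    using d[of i] by (simp add: \<beta>_def d_def field_simps)
  have \<alpha>_add: "\<alpha> i (y + z) = \<alpha> i y + \<alpha> i z" for i y z
    by (simp add: \<alpha>_def add_divide_distrib[symmetric] algebra_simps)
  have \<beta>_add: "\<beta> i (y + z) = \<beta> i y + \<beta> i z" for i y z
    by (simp add: \<beta>_def add_divide_distrib[symmetric] algebra_simps)
  have \<alpha>_scale: "\<alpha> i (of_int k * z) = of_int k * \<alpha> i z" for i k z
    by (simp add: \<alpha>_def diff_divide_distrib algebra_simps)
  have \<beta>_scale: "\<beta> i (of_int k * z) = of_int k * \<beta> i z" for i k z
    by (simp add: \<beta>_def diff_divide_distrib algebra_simps)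
  define a where "a x = (\<chi> i. \<alpha> i (coord x $ i))" for x
  define b where "b x = (\<chi> i. \<beta> i (coord x $ i))" for x
  show thesis
  proof (rule that[of a b])
    show "bij (\<lambda>x. (a x, b x))"
    proof (rule bij_betwI')
      show "(a x, b x) = (a y, b y) \<longleftrightarrow> x = y" for x y
      proof
        assume eq: "(a x, b x) = (a y, b y)"
        then have "\<alpha> i (coord x $ i) = \<alpha> i (coord y $ i)" "\<beta> i (coord x $ i) = \<beta> i (coord y $ i)" for i
          by (auto simp: a_def b_def vec_eq_iff)
        then show "x = y" by (intro coord_eqI) (metis expand)
      qed simp
      show "\<exists>x\<in>UNIV. p = (a x, b x)" for p
        by (intro bexI[of _ "P *v (\<chi> i. of_real (fst p $ i) * u i + of_real (snd p $ i) * v i)"])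
           (auto simp: a_def b_def coord_P \<alpha> \<beta> vec_eq_iff prod_eq_iff)
    qed simp
  next
    fix x i assume "x \<in> \<Lambda>"
    then have "2 * coord x $ i \<in> doubled_projection i" by (simp add: doubled_projection_def)
    then obtain k m :: int where km: "2 * coord x $ i = of_int k * u i + 2 * of_int m * v i"
      using basis by blast
    \<comment> \<open>Halving the coefficients \<open>k\<close> and \<open>2 m\<close> leaves a
      possible half-integer only at \<open>u i\<close>; this is the gain from the adapted
      basis.\<close>
    have "coord x $ i = of_real (of_int k / 2) * u i + of_real (of_int m) * v i"
      using km by (simp add: field_simps)
    then show "2 * a x $ i \<in> \<int> \<and> b x $ i \<in> \<int>"
      by (simp only: a_def b_def vec_lambda_beta \<alpha> \<beta>) simp
  next
    fix x assume int: "\<And>i. a x $ i \<in> \<int> \<and> b x $ i \<in> \<int>"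
    \<comment> \<open>With integral coordinates each axis component is an integral combination of
      lattice vectors on that axis, and \<open>x\<close> is the sum of these components.\<close>
    have "P *v axis i (coord x $ i) \<in> \<Lambda>" for i
    proof -
      obtain k m :: int where km: "\<alpha> i (coord x $ i) = of_int k" "\<beta> i (coord x $ i) = of_int m"
        using int[of i] by (auto simp: a_def b_def elim!: Ints_cases)
      have "coord x $ i = of_int k * u i + of_int m * v i"
        using expand[of i "coord x $ i"] km by simp
      then have "P *v axis i (coord x $ i) = of_int k *s (P *v axis i (u i)) + of_int m *s (P *v axis i (v i))"
        by (simp add: P_axis_add P_axis_scale)
      also have "\<dots> \<in> \<Lambda>"
        using u[of i] v[of i]
        by (intro translation_add translation_of_int_scale) (simp_all add: line_lattice_def)
      finally show ?thesis .
    qed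
    then have "(\<Sum>i\<in>UNIV. P *v axis i (coord x $ i)) \<in> \<Lambda>"
      by (intro translation_sum)
    also have "(\<Sum>i\<in>UNIV. P *v axis i (coord x $ i)) = P *v (\<Sum>i\<in>UNIV. axis i (coord x $ i))"
      by (simp add: vec.linear_sum[OF matrix_vector_mul_linear_gen] o_def)
    also have "(\<Sum>i\<in>UNIV. axis i (coord x $ i)) = coord x"
      by (simp add: vec_eq_iff axis_def)
    finally show "x \<in> \<Lambda>" by (simp add: P_coord)
  next
    show "a (x + y) = a x + a y" "b (x + y) = b x + b y" for x y
      by (simp_all add: a_def b_def vec_eq_iff coord_add \<alpha>_add \<beta>_add)
  next
    fix A x i assume A: "A \<in> holonomy \<Gamma>"
    show "a (A *v x) $ i = of_int (\<rho> A $ i $ i) * a x $ i" "b (A *v x) $ i = of_int (\<rho> A $ i $ i) * b x $ i"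
      by (simp_all only: a_def b_def vec_lambda_beta coord_act[OF A] \<alpha>_scale \<beta>_scale)
  qed
qed

end

section \<open>The splitting of the lattice\<close>

context CHW_diagonal begin

lemma lattice_splitting:
  "\<exists>L\<^sub>1 L\<^sub>2.
    invariant_subgroup (holonomy \<Gamma>) L\<^sub>1 \<and>
    invariant_subgroup (holonomy \<Gamma>) L\<^sub>2 \<and>
    \<Lambda> = {x + y | x y. x \<in> L\<^sub>1 \<and> y \<in> L\<^sub>2} \<and>
    L\<^sub>1 \<inter> L\<^sub>2 = {0} \<and>
    equivariantly_isomorphic (holonomy \<Gamma>) (*v) L\<^sub>1 (\<lambda>A. (*v) (\<rho> A)) (UNIV :: (int^'n) set) \<and>
    rationally_isomorphic (holonomy \<Gamma>) L\<^sub>1 L\<^sub>2"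
proof -
  obtain a b :: "complex^'n \<Rightarrow> real^'n"
    where add: "\<And>x y. a (x + y) = a x + a y" "\<And>x y. b (x + y) = b x + b y"
      and act: "\<And>A x i. A \<in> holonomy \<Gamma> \<Longrightarrow> a (A *v x) $ i = of_int (\<rho> A $ i $ i) * a x $ i"
        "\<And>A x i. A \<in> holonomy \<Gamma> \<Longrightarrow> b (A *v x) $ i = of_int (\<rho> A $ i $ i) * b x $ i"
      and bij: "bij (\<lambda>x. (a x, b x))"
      and \<Lambda>_half: "\<And>x i. x \<in> \<Lambda> \<Longrightarrow> 2 * a x $ i \<in> \<int> \<and> b x $ i \<in> \<int>"
      and \<Lambda>I: "\<And>x. (\<And>i. a x $ i \<in> \<int> \<and> b x $ i \<in> \<int>) \<Longrightarrow> x \<in> \<Lambda>"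
    by (rule adapted_real_coordinates) blast
  define mk where "mk p q = inv_into UNIV (\<lambda>x. (a x, b x)) (p, q)" for p q
  have mk: "a (mk p q) = p" "b (mk p q) = q" for p q
    using surj_f_inv_f[OF bij_is_surj[OF bij], of "(p, q)"] by (simp_all add: mk_def)
  have eqI: "x = y" if "a x = a y" "b x = b y" for x y
    using bij_is_inj[OF bij] that by (simp add: inj_def)
  have zero: "a 0 = 0" "b 0 = 0" using add(1)[of 0 0] add(2)[of 0 0] by simp_all
  have minus: "a (- x) = - a x" "b (- x) = - b x" for x
    using add(1)[of x "- x"] add(2)[of x "- x"] zero by (simp_all add: eq_neg_iff_add_eq_0 add.commute)
  \<comment> \<open>Integral coordinates already place \<open>L\<^sub>1\<close> in the lattice. In
    \<open>L\<^sub>2\<close> the \<open>a\<close>-coordinates may be half-integers, and which ones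
    occur depends on the lattice, so \<open>L\<^sub>2\<close> is cut out of it.\<close>
  define L\<^sub>1 where "L\<^sub>1 = {x. a x = 0 \<and> (\<forall>i. b x $ i \<in> \<int>)}"
  define L\<^sub>2 where "L\<^sub>2 = {x \<in> \<Lambda>. b x = 0}"
  have L\<^sub>1_subset: "L\<^sub>1 \<subseteq> \<Lambda>" using \<Lambda>I by (auto simp: L\<^sub>1_def)
  have act_zero: "a x = 0 \<Longrightarrow> a (A *v x) = 0" "b x = 0 \<Longrightarrow> b (A *v x) = 0"
    if "A \<in> holonomy \<Gamma>" for A x using act[OF that] by (simp_all add: vec_eq_iff)
  have inv1: "invariant_subgroup (holonomy \<Gamma>) L\<^sub>1"
    by (auto simp: invariant_subgroup_def L\<^sub>1_def zero add minus act act_zero)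
  have inv2: "invariant_subgroup (holonomy \<Gamma>) L\<^sub>2"
    by (auto simp: invariant_subgroup_def L\<^sub>2_def zero add minus act_zero
        translation_zero translation_add translation_uminus translation_act)
  have "x \<in> {x + y | x y. x \<in> L\<^sub>1 \<and> y \<in> L\<^sub>2}" if "x \<in> \<Lambda>" for x
  proof -
    \<comment> \<open>The \<open>v\<close>-component of \<open>x\<close>: its coordinates are
      integral, so it is a lattice vector, and hence so is the remainder.\<close>
    let ?y = "mk 0 (b x)"
    have y: "?y \<in> L\<^sub>1" using \<Lambda>_half[OF that] by (simp add: L\<^sub>1_def mk)
    moreover have "x - ?y \<in> L\<^sub>2"
      using translation_diff[OF that] y L\<^sub>1_subset add(2)[of x "- ?y"]
      by (auto simp: L\<^sub>2_def minus mk)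
    moreover have "x = ?y + (x - ?y)" by simp
    ultimately show ?thesis by blast
  qed
  then have sum: "\<Lambda> = {x + y | x y. x \<in> L\<^sub>1 \<and> y \<in> L\<^sub>2}"
    using L\<^sub>1_subset translation_add by (auto simp: L\<^sub>2_def)
  have int: "L\<^sub>1 \<inter> L\<^sub>2 = {0}"
    using eqI[of _ 0] by (auto simp: L\<^sub>1_def L\<^sub>2_def zero translation_zero)
  have "equivariantly_isomorphic (holonomy \<Gamma>) (*v) L\<^sub>1 (\<lambda>A. (*v) (\<rho> A)) (UNIV :: (int^'n) set)"
    unfolding equivariantly_isomorphic_def
  proof (intro exI conjI ballI)
    \<comment> \<open>On \<open>L\<^sub>1\<close> the floor only changes the type, since the
      \<open>b\<close>-coordinates are integers there.\<close>
    let ?f = "\<lambda>x. (\<chi> i. \<lfloor>b x $ i\<rfloor>) :: int^'n"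
    let ?g = "\<lambda>k. mk 0 (\<chi> i. of_int (k $ i))"
    have f: "of_int (?f x $ i) = b x $ i" if "x \<in> L\<^sub>1" for x i
      using that by (auto simp: L\<^sub>1_def elim: Ints_cases)
    show "bij_betw ?f L\<^sub>1 UNIV"
    proof (rule bij_betwI[where g = ?g])
      show "?g (?f x) = x" if "x \<in> L\<^sub>1" for x
        using that f[OF that] by (intro eqI) (auto simp: mk L\<^sub>1_def vec_eq_iff)
    qed (auto simp: L\<^sub>1_def mk vec_eq_iff)
    show "?f (x + y) = ?f x + ?f y" if x: "x \<in> L\<^sub>1" and y: "y \<in> L\<^sub>1" for x y
    proof -
      have "?f (x + y) $ i = ?f x $ i + ?f y $ i" for i
      proof -
        obtain k m where "b x $ i = of_int k" "b y $ i = of_int m"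
          using x y by (metis (mono_tags, lifting) Ints_cases L\<^sub>1_def mem_Collect_eq)
        then show ?thesis by (simp add: add flip: of_int_add)
      qed
      then show ?thesis by (simp add: vec_eq_iff)
    qed
    show "?f (A *v x) = \<rho> A *v ?f x" if A: "A \<in> holonomy \<Gamma>" and x: "x \<in> L\<^sub>1" for A x
    proof -
      have "?f (A *v x) $ i = (\<rho> A *v ?f x) $ i" for i
      proof -
        obtain k where "b x $ i = of_int k"
          using x by (metis (mono_tags, lifting) Ints_cases L\<^sub>1_def mem_Collect_eq)
        then show ?thesis
          unfolding \<rho>_mult_vec[OF A] vec_lambda_beta act(2)[OF A] by (simp flip: of_int_mult)
      qed
      then show ?thesis by (simp add: vec_eq_iff)
    qed
  qed
  moreover
  \<comment> \<open>Exchanging \<open>u i\<close> and \<open>v i\<close> on every axis commutes with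
    the holonomy, as both have the same sign. It maps \<open>L\<^sub>1\<close> into
    \<open>L\<^sub>2\<close>; the way back needs the factor 2 to clear the half-integers.\<close>
  define S where "S x = mk (b x) (a x)" for x
  have S: "a (S x) = b x" "b (S x) = a x" for x by (simp_all add: S_def mk)
  have S_add: "S (x + y) = S x + S y" for x y by (rule eqI) (simp_all add: S add)
  have SS: "S (S x) = x" for x by (rule eqI) (simp_all add: S)
  have S_act: "S (A *v x) = A *v S x" if "A \<in> holonomy \<Gamma>" for A x
    by (rule eqI) (simp_all add: vec_eq_iff S act[OF that])
  have "rationally_isomorphic (holonomy \<Gamma>) L\<^sub>1 L\<^sub>2"
  proof (rule rationally_isomorphicI[where f = S and g = "\<lambda>y. S y + S y"])
    show "additive_between L\<^sub>1 L\<^sub>2 S"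
    proof
      show "S x \<in> L\<^sub>2" if "x \<in> L\<^sub>1" for x
        using that \<Lambda>I[of "S x"] by (auto simp: L\<^sub>1_def L\<^sub>2_def S)
    qed (use inv1 inv2 in \<open>auto simp: invariant_subgroup_def S_add\<close>)
    show "additive_between L\<^sub>2 L\<^sub>1 (\<lambda>y. S y + S y)"
    proof
      show "S y + S y \<in> L\<^sub>1" if "y \<in> L\<^sub>2" for y
      proof -
        have "a (S y + S y) = 0" using that unfolding add S by (simp add: L\<^sub>2_def)
        moreover have "b (S y + S y) $ i = 2 * a y $ i" for i unfolding add S by simp
        ultimately show ?thesis using that \<Lambda>_half[of y] by (simp add: L\<^sub>1_def L\<^sub>2_def)
      qed
    qed (use inv1 inv2 in \<open>auto simp: invariant_subgroup_def S_add algebra_simps\<close>)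
    show "S (S y + S y) = y + y" for y by (simp only: S_add SS)
  qed (use inv1 inv2 in \<open>auto simp only: invariant_subgroup_def SS S_act\<close>)
  ultimately show ?thesis using inv1 inv2 sum int by blast
qed

end

theorem corollary1:
  fixes \<Gamma> :: "((complex^'n^'n) \<times> (complex^'n)) set"
  assumes "CHW_group \<Gamma>"
  shows "(\<exists>\<rho>. diagonal_rep \<Gamma> \<rho>) \<and>
    (\<forall>\<rho>. diagonal_rep \<Gamma> \<rho> \<longrightarrow>
      (\<exists>L\<^sub>1 L\<^sub>2.
        invariant_subgroup (holonomy \<Gamma>) L\<^sub>1 \<and>
        invariant_subgroup (holonomy \<Gamma>) L\<^sub>2 \<and>
        translation_lattice \<Gamma> = {x + y | x y. x \<in> L\<^sub>1 \<and> y \<in> L\<^sub>2} \<and>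
        L\<^sub>1 \<inter> L\<^sub>2 = {0} \<and>
        equivariantly_isomorphic (holonomy \<Gamma>)
          (*v) L\<^sub>1 (\<lambda>A. (*v) (\<rho> A)) (UNIV :: (int^'n) set) \<and>
        rationally_isomorphic (holonomy \<Gamma>) L\<^sub>1 L\<^sub>2))"
proof (intro conjI allI impI)
  interpret CHW \<Gamma> by standard (rule assms)
  show "\<exists>\<rho>. diagonal_rep \<Gamma> \<rho>" by (rule diagonal_rep_exists)
  fix \<rho> assume "diagonal_rep \<Gamma> \<rho>"
  \<comment> \<open>The splitting is built in the basis belonging to the given \<rho>, so the module
    structure of \<open>L\<^sub>1\<close> is the one prescribed by that \<rho>.\<close>
  then obtain P where "invertible P" "\<forall>A\<in>holonomy \<Gamma>. A ** P = P ** map_matrix of_int (\<rho> A)"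
    "\<rho> ` holonomy \<Gamma> = diagonal_sign_matrices"
    by (auto simp: diagonal_rep_def)
  then interpret CHW_diagonal \<Gamma> \<rho> P
    by unfold_locales auto
  show "\<exists>L\<^sub>1 L\<^sub>2.
        invariant_subgroup (holonomy \<Gamma>) L\<^sub>1 \<and>
        invariant_subgroup (holonomy \<Gamma>) L\<^sub>2 \<and>
        translation_lattice \<Gamma> = {x + y | x y. x \<in> L\<^sub>1 \<and> y \<in> L\<^sub>2} \<and>
        L\<^sub>1 \<inter> L\<^sub>2 = {0} \<and>
        equivariantly_isomorphic (holonomy \<Gamma>)
          (*v) L\<^sub>1 (\<lambda>A. (*v) (\<rho> A)) (UNIV :: (int^'n) set) \<and>
        rationally_isomorphic (holonomy \<Gamma>) L\<^sub>1 L\<^sub>2"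
    by (rule lattice_splitting)
qed

end
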